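(* Let $\mathcal{F}=\{\mathcal{P}(p)\mid p\in\mathbb{R}\setminus\{0\}\}$ be the confocal family of parabolas $\mathcal{P}(p): y^2=2px+p^2$, and for $E=(x_E,y_E)\in\mathbb{R}^2$ let $\mathcal{D}(E)$ be the unit circle centered at $E$. Put $$\mathcal{Q}^6_2(x,y,p)=4(x^2+y^2)(x^2+y^2+1)p^2+4x(2x^2+2y^2+1)(x^2+y^2-1)p+(3x^2-y^2+1)(x^2+y^2-1)^2,$$ let $\Gamma^6$, $\Gamma^6_+$, $\Gamma^6_-$ be the sets of $(x,y)\in\mathbb{R}^2$ at which $(x^2+y^2)^3-y^2$ is respectively $=0$, $>0$, $<0$, and let $\Sigma=\{(x,y)\in\mathbb{R}^2\mid x^2+y^2=1\}\cup\{(0,0)\}$. Then for every $E\in\mathbb{R}^2\setminus\Sigma$ there exist(s): a) two $6$-Poncelet pairs $(\mathcal{D}(E),\mathcal{P}(p_\pm))$, corresponding to two distinct real zeros $p_\pm$ (in $p$) of $\mathcal{Q}^6_2(x_E,y_E,p)$, if $E\in\Gamma^6_+\setminus\Sigma$; the zeros are given by $$p_\pm(E)=\frac{\left(-x_E(2x_E^2+2y_E^2+1)\pm\sqrt{(x_E^2+y_E^2)^3-y_E^2}\right)(x_E^2+y_E^2-1)}{2(x_E^2+y_E^2)(x_E^2+y_E^2+1)};$$ b) one $6$-Poncelet pair $(\mathcal{D}(E),\mathcal{P}(p))$, corresponding to the real zero with multiplicity $2$, if $E\in\Gamma^6\setminus\Sigma$, satisfying $$p(E)=p_+(E)=p_-(E),\qquad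 \operatorname{sign}(p_\pm)=\operatorname{sign}(x_E),$$ and the zero is given by $$p(E)=-\frac{\sqrt{1-y_E^{4/3}}\left(2y_E^{2/3}+1\right)\left(y_E^{2/3}-1\right)}{2y_E^{1/3}\left(y_E^{2/3}+1\right)},\qquad y_E\in(0,1);$$ c) no real $6$-Poncelet pair if $E\in\Gamma^6_-$.
   Context: For $n\ge 3$ and two smooth conics $\mathcal{C}_1,\mathcal{C}_2$, an $n$-Poncelet polygon is an $n$-gon inscribed in $\mathcal{C}_1$ and circumscribed about $\mathcal{C}_2$ (the polygons are in general considered in $\mathbb{CP}^2$, so they need not be real); a $k$-gon traversed $m>1$ times is not regarded as an $mk$-gon. The pair $(\mathcal{C}_1,\mathcal{C}_2)$ is an $n$-Poncelet pair if there exists such an $n$-gon. All parabolas $\mathcal{P}(p)$ have focus $(0,0)$ and the $x$-axis as axis of symmetry.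
   Formalization: In a), if 3x_E²−y_E²+1=0 one of p_± is 0, not in the family (e.g. E=(1,2)), so only the nonzero zero gives a pair; in b), the printed formula is positive, contradicting sign(p)=sign(x_E) for x_E<0, so it is multiplied by sign(x_E). *)

theory Defs
  imports "HOL-Analysis.Analysis" "HOL-Computational_Algebra.Polynomial"
begin

section \<open>Conics in the complex projective plane\<close>

text \<open>
  Points of the complex projective plane are given by nonzero vectors of homogeneous
  coordinates in \<^typ>\<open>complex^3\<close>, up to a nonzero scalar; the affine point \<open>(x, y)\<close> is
  \<open>(x : y : 1)\<close>.  A conic is given by a symmetric matrix.
  The form below is bilinear over the complex numbers; the library's
  inner product on \<^typ>\<open>complex^3\<close> is real-valued and must not be used here.
\<close>

type_synonym conic = "complex^3^3"

definition same_point :: "complex^3 \<Rightarrow> complex^3 \<Rightarrow> bool" where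
  "same_point u v \<longleftrightarrow> (\<exists>c. c \<noteq> 0 \<and> u = c *s v)"

definition conic_form :: "conic \<Rightarrow> complex^3 \<Rightarrow> complex^3 \<Rightarrow> complex" where
  "conic_form A u v = (\<Sum>i\<in>UNIV. \<Sum>j\<in>UNIV. u $ i * A $ i $ j * v $ j)"

definition on_conic :: "conic \<Rightarrow> complex^3 \<Rightarrow> bool" where
  "on_conic A u \<longleftrightarrow> u \<noteq> 0 \<and> conic_form A u u = 0"

text \<open>The gradient of the quadratic form of \<open>A\<close> at \<open>u\<close> is \<open>2 A u\<close>.\<close>

definition smooth_conic :: "conic \<Rightarrow> bool" where
  "smooth_conic A \<longleftrightarrow> transpose A = A \<and> (\<forall>u. on_conic A u \<longrightarrow> A *v u \<noteq> 0)"

text \<open>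
  For distinct points \<open>u\<close> and \<open>v\<close>: the line joining them is tangent to the smooth conic \<open>A\<close>,
  i.e. it is the tangent line \<open>{w. conic_form A q w = 0}\<close> of \<open>A\<close> at some point \<open>q\<close> of \<open>A\<close>.
\<close>

definition join_tangent :: "conic \<Rightarrow> complex^3 \<Rightarrow> complex^3 \<Rightarrow> bool" where
  "join_tangent A u v \<longleftrightarrow>
     (\<exists>q. on_conic A q \<and> conic_form A q u = 0 \<and> conic_form A q v = 0)"

text \<open>
  An \<open>n\<close>-gon with vertices \<open>v 0, \<dots>, v (n - 1)\<close>.  The vertices are pairwise distinct, so a
  \<open>k\<close>-gon traversed several times is not counted.  Since a smooth conic
  contains no three collinear points, the sides are then pairwise distinct as well.
\<close>

definition poncelet_polygon :: "nat \<Rightarrow> conic \<Rightarrow> conic \<Rightarrow> (nat \<Rightarrow> complex^3) \<Rightarrow> bool" where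
  "poncelet_polygon n C1 C2 v \<longleftrightarrow>
     (\<forall>i<n. on_conic C1 (v i)) \<and>
     (\<forall>i<n. \<forall>j<n. i \<noteq> j \<longrightarrow> \<not> same_point (v i) (v j)) \<and>
     (\<forall>i<n. join_tangent C2 (v i) (v (Suc i mod n)))"

definition poncelet_pair :: "nat \<Rightarrow> conic \<Rightarrow> conic \<Rightarrow> bool" where
  "poncelet_pair n C1 C2 \<longleftrightarrow>
     n \<ge> 3 \<and> smooth_conic C1 \<and> smooth_conic C2 \<and> (\<exists>v. poncelet_polygon n C1 C2 v)"

section \<open>Unit circles and confocal parabolas\<close>

definition unit_circle :: "real \<Rightarrow> real \<Rightarrow> conic" where
  "unit_circle a b = vector
     [vector [1, 0, - of_real a],
      vector [0, 1, - of_real b],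
      vector [- of_real a, - of_real b, of_real (a\<^sup>2 + b\<^sup>2 - 1)]]"

definition parabola :: "real \<Rightarrow> conic" where
  "parabola p = vector
     [vector [0, 0, - of_real p],
      vector [0, 1, 0],
      vector [- of_real p, 0, - of_real (p\<^sup>2)]]"

lemma on_unit_circle_affine:
  "on_conic (unit_circle a b) (vector [x, y, 1]) \<longleftrightarrow>
     (x - of_real a)\<^sup>2 + (y - of_real b)\<^sup>2 = 1"
proof -
  have "(vector [x, y, 1] :: complex^3) \<noteq> 0"
    by (auto simp: vec_eq_iff forall_3)
  then show ?thesis
    by (simp add: on_conic_def conic_form_def unit_circle_def sum_3)
       (auto simp: algebra_simps power2_eq_square)
qed

lemma on_parabola_affine:
  "on_conic (parabola p) (vector [x, y, 1]) \<longleftrightarrow> y\<^sup>2 = 2 * of_real p * x + (of_real p)\<^sup>2"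
proof -
  have "(vector [x, y, 1] :: complex^3) \<noteq> 0"
    by (auto simp: vec_eq_iff forall_3)
  then show ?thesis
    by (simp add: on_conic_def conic_form_def parabola_def sum_3)
       (auto simp: algebra_simps power2_eq_square)
qed

text \<open>
  The parameters \<open>p\<close> of the members of the confocal family (\<open>p \<noteq> 0\<close>) that form an
  \<open>n\<close>-Poncelet pair with the unit circle centred at \<open>(x, y)\<close>; distinct parameters give
  distinct parabolas.
\<close>

definition poncelet_params :: "nat \<Rightarrow> real \<Rightarrow> real \<Rightarrow> real set" where
  "poncelet_params n x y = {p. p \<noteq> 0 \<and> poncelet_pair n (unit_circle x y) (parabola p)}"

section \<open>The polynomial and the curve for hexagons\<close>

text \<open>\<open>Q62 x y\<close> is a polynomial in the variable \<open>p\<close>, constant coefficient first.\<close>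

definition Q62 :: "real \<Rightarrow> real \<Rightarrow> real poly" where
  "Q62 x y =
     [:(3 * x\<^sup>2 - y\<^sup>2 + 1) * (x\<^sup>2 + y\<^sup>2 - 1)\<^sup>2,
       4 * x * (2 * x\<^sup>2 + 2 * y\<^sup>2 + 1) * (x\<^sup>2 + y\<^sup>2 - 1),
       4 * (x\<^sup>2 + y\<^sup>2) * (x\<^sup>2 + y\<^sup>2 + 1):]"

definition Gamma6 :: "(real \<times> real) set" where
  "Gamma6 = {(x, y). (x\<^sup>2 + y\<^sup>2) ^ 3 - y\<^sup>2 = 0}"

definition Gamma6_pos :: "(real \<times> real) set" where
  "Gamma6_pos = {(x, y). (x\<^sup>2 + y\<^sup>2) ^ 3 - y\<^sup>2 > 0}"

definition Gamma6_neg :: "(real \<times> real) set" where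
  "Gamma6_neg = {(x, y). (x\<^sup>2 + y\<^sup>2) ^ 3 - y\<^sup>2 < 0}"

definition Sigma6 :: "(real \<times> real) set" where
  "Sigma6 = {(x, y). x\<^sup>2 + y\<^sup>2 = 1} \<union> {(0, 0)}"

definition p_plus :: "real \<Rightarrow> real \<Rightarrow> real" where
  "p_plus x y =
     (- x * (2 * x\<^sup>2 + 2 * y\<^sup>2 + 1) + sqrt ((x\<^sup>2 + y\<^sup>2) ^ 3 - y\<^sup>2)) * (x\<^sup>2 + y\<^sup>2 - 1)
       / (2 * (x\<^sup>2 + y\<^sup>2) * (x\<^sup>2 + y\<^sup>2 + 1))"

definition p_minus :: "real \<Rightarrow> real \<Rightarrow> real" where
  "p_minus x y =
     (- x * (2 * x\<^sup>2 + 2 * y\<^sup>2 + 1) - sqrt ((x\<^sup>2 + y\<^sup>2) ^ 3 - y\<^sup>2)) * (x\<^sup>2 + y\<^sup>2 - 1)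
       / (2 * (x\<^sup>2 + y\<^sup>2) * (x\<^sup>2 + y\<^sup>2 + 1))"

end

theory Submission
  imports Defs
begin

text \<open>
  The finite tangents of the parabola are the lines \<open>p (s\<^sup>2 + 1) + 2 x = 2 s y\<close>, and the line at
  infinity corresponds to \<open>s = \<infinity>\<close>.  A point of the plane is an unordered pair \<open>{s, t}\<close> of tangents, and
  it lies on the circle iff a symmetric biquadratic form in \<open>s, t\<close> vanishes.  A Poncelet polygon is thus
  a cyclic sequence of parameters whose successive terms are related by this \<open>(2, 2)\<close> correspondence;
  by Vieta, the two neighbours of \<open>s\<close> satisfy
  \<open>(s\<^sup>2 + 1) (s\<^sub>+ + s\<^sub>-) = 2 (m s + n)\<close>.  Running three steps in both directions from one
  tangent \<open>t\<close> and comparing the results leaves \<open>hexpol \<cdot> (t\<^sup>2 + 1)\<^sup>2 = 0\<close>, where \<open>hexpol\<close> is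
  \<open>Q62\<close> up to a nonzero factor and does not depend on \<open>t\<close>.  Conversely, when \<open>Q62\<close> vanishes,
  the orbit of the line at infinity, whose neighbours are the isotropic tangents \<open>\<plusminus> \<i>\<close>, closes up
  after six steps and has distinct vertices, except for one root on the axis \<open>y = 0\<close>, where it folds
  back on itself and another orbit is used.
\<close>

section \<open>The correspondence between adjacent tangents\<close>

text \<open>
  With \<open>m = 2a/p\<close>, \<open>n = 2b/p\<close>, \<open>d = 4(1 - a\<^sup>2 - b\<^sup>2)/p\<^sup>2\<close> this is the equation of the unit circle
  centred at \<open>(a, b)\<close>, divided by \<open>p\<^sup>2\<close>, at the intersection of the tangents \<open>s\<close> and \<open>t\<close>.
\<close>

definition hedge :: "complex \<Rightarrow> complex \<Rightarrow> complex \<Rightarrow> complex \<Rightarrow> complex \<Rightarrow> complex" where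
  "hedge m n d s t = (s\<^sup>2 + 1) * (t\<^sup>2 + 1) - 2 * m * (s * t - 1) - 2 * n * (s + t) - d"

definition hexpol :: "complex \<Rightarrow> complex \<Rightarrow> complex \<Rightarrow> complex" where
  "hexpol m n d = 16 * (m\<^sup>2 + n\<^sup>2) * (2 * (m\<^sup>2 + n\<^sup>2) + d) - 8 * m * (3 * (m\<^sup>2 + n\<^sup>2) + d) * d
      + (4 * m\<^sup>2 + d) * d\<^sup>2"

lemma hedge_commute: "hedge m n d s t = hedge m n d t s"
  by (simp add: hedge_def algebra_simps)

text \<open>Vieta for the quadratic in the second argument, by dividing the difference of the two
  equations by \<open>y - z\<close>. It therefore survives a vanishing leading coefficient, which
  later excludes isotropic sides.\<close>

lemma hedge_sum:
  assumes "hedge m n d t y = 0" "hedge m n d t z = 0" "y \<noteq> z"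
  shows "(t\<^sup>2 + 1) * (y + z) = 2 * (m * t + n)"
proof -
  have "(y - z) * ((t\<^sup>2 + 1) * (y + z) - 2 * (m * t + n)) = hedge m n d t y - hedge m n d t z"
    unfolding hedge_def by algebra
  then show ?thesis using assms by simp
qed

lemma hedge_prod:
  assumes "hedge m n d t y = 0" "hedge m n d t z = 0" "y \<noteq> z"
  shows "(t\<^sup>2 + 1) * (y * z) = t\<^sup>2 - 2 * n * t + 1 + 2 * m - d"
proof -
  have "(t\<^sup>2 + 1) * (y * z) - (t\<^sup>2 - 2 * n * t + 1 + 2 * m - d)
      = y * ((t\<^sup>2 + 1) * (y + z) - 2 * (m * t + n)) - hedge m n d t y"
    unfolding hedge_def by algebra
  then show ?thesis using assms hedge_sum[OF assms] by simp
qed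

text \<open>
  \<open>A X\<^sup>2 - 2 (m t + n) X + \<dots>\<close> and \<open>U X\<^sup>2 - B X + C\<close> are the quadratics with roots the first and the
  second neighbours of \<open>t\<close>.
\<close>

lemma closing_identity:
  fixes m n d t :: complex
  defines "k \<equiv> m\<^sup>2 + n\<^sup>2"
  defines "A \<equiv> t\<^sup>2 + 1"
  defines "U \<equiv> 4*k*t\<^sup>2 + 4*n*d*t + 4*k - 4*m*d + d\<^sup>2"
  defines "B \<equiv> -4*n*d*t\<^sup>2 + (8*m*k - 4*m\<^sup>2*d + 8*m*d - 2*d\<^sup>2)*t + 4*n*(2*k - m*d + d)"
  defines "C \<equiv> (4*k - 4*m*d + d\<^sup>2)*t\<^sup>2 - 4*n*(2*k - m*d + d)*t + 4*(k + 2*m*k - m\<^sup>2*d)"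
  shows "4*(m*d - 2*k)*A*(m*U - n*B - m*C) - ((C - U)\<^sup>2 + B\<^sup>2) = - d * hexpol m n d * A\<^sup>2"
  unfolding hexpol_def k_def A_def U_def B_def C_def by algebra

text \<open>The sides in cyclic order are \<open>t, y, s, w, r, z\<close>: two arms leave
  \<open>t\<close> and meet at the opposite side \<open>w\<close>. Exchanging the arms swaps
  \<open>y, s\<close> with \<open>z, r\<close>, so everything reduces to symmetric functions of
  \<open>y, z\<close> and a factor \<open>y - z\<close>.\<close>

lemma hexpol_generic:
  assumes "hedge m n d t y = 0" "hedge m n d t z = 0" "y \<noteq> z"
    and "hedge m n d y s = 0" "s \<noteq> t" "hedge m n d z r = 0" "r \<noteq> t"
    and "hedge m n d s w = 0" "w \<noteq> y" "hedge m n d r w = 0" "w \<noteq> z"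
    and nz: "t\<^sup>2 + 1 \<noteq> 0" "y\<^sup>2 + 1 \<noteq> 0" "z\<^sup>2 + 1 \<noteq> 0" "d \<noteq> 0"
  shows "hexpol m n d = 0"
proof -
  define k where "k = m\<^sup>2 + n\<^sup>2"
  define A where "A = t\<^sup>2 + 1"
  define U where "U = 4*k*t\<^sup>2 + 4*n*d*t + 4*k - 4*m*d + d\<^sup>2"
  define B where "B = -4*n*d*t\<^sup>2 + (8*m*k - 4*m\<^sup>2*d + 8*m*d - 2*d\<^sup>2)*t + 4*n*(2*k - m*d + d)"
  define C where "C = (4*k - 4*m*d + d\<^sup>2)*t\<^sup>2 - 4*n*(2*k - m*d + d)*t + 4*(k + 2*m*k - m\<^sup>2*d)"
  define Y where "Y = y + z"
  define K where "K = y * z"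
  have Y: "A * Y = 2 * (m * t + n)" and K: "A * K = t\<^sup>2 - 2 * n * t + 1 + 2 * m - d"
    unfolding A_def Y_def K_def by (rule hedge_sum[OF assms(1-3)], rule hedge_prod[OF assms(1-3)])
  have s: "(y\<^sup>2 + 1) * (t + s) = 2 * (m * y + n)" and r: "(z\<^sup>2 + 1) * (t + r) = 2 * (m * z + n)"
    using assms by (auto intro!: hedge_sum[of m n d] simp del: distrib_left_numeral simp: hedge_commute[of _ _ _ _ t])
  have w: "(s\<^sup>2 + 1) * (y + w) = 2 * (m * s + n)" "(r\<^sup>2 + 1) * (z + w) = 2 * (m * r + n)"
    using assms by (auto intro!: hedge_sum[of m n d] simp del: distrib_left_numeral simp: hedge_commute[of _ _ _ s] hedge_commute[of _ _ _ r])
  \<comment> \<open>The common denominator of \<open>s\<close> and \<open>r\<close>, rewritten in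
    \<open>K - 1\<close> and \<open>Y\<close>; the factor \<open>A\<^sup>2\<close> turns it into
    \<open>U\<close>.\<close>
  have yz: "(y\<^sup>2 + 1) * (z\<^sup>2 + 1) = (K - 1)\<^sup>2 + Y\<^sup>2"
    unfolding K_def Y_def by algebra
  have "A\<^sup>2 * ((K - 1)\<^sup>2 + Y\<^sup>2) = (A * K - A)\<^sup>2 + (A * Y)\<^sup>2" by algebra
  also have "\<dots> = U" unfolding Y K unfolding U_def A_def k_def by algebra
  finally have U: "A\<^sup>2 * ((y\<^sup>2 + 1) * (z\<^sup>2 + 1)) = U" using yz by simp
  have U0: "U \<noteq> 0" using U nz by (auto simp: A_def)
  \<comment> \<open>\<open>s - r\<close> changes sign when the arms are exchanged, so
    \<open>y - z\<close> splits off. The symmetric \<open>s + r\<close> and \<open>s * r\<close>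
    become \<open>B / U\<close> and \<open>C / U\<close>.\<close>
  have "(y\<^sup>2 + 1) * (z\<^sup>2 + 1) * (s - r) = 2 * (y - z) * (m - n * Y - m * K)"
    using s r unfolding K_def Y_def by algebra
  then have "U * (s - r) = 2 * (y - z) * A * (m * A - n * (A * Y) - m * (A * K))"
    unfolding U[symmetric] by algebra
  then have diff: "U * (s - r) = 2 * (y - z) * A * (m * d - 2 * k)"
    unfolding Y K unfolding A_def k_def by algebra
  have "(y\<^sup>2 + 1) * (z\<^sup>2 + 1) * (s + r + 2 * t) = 2 * (m * (K + 1) * Y + n * (Y\<^sup>2 - 2 * K + 2))"
    using s r unfolding K_def Y_def by algebra
  then have "U * (s + r + 2 * t) = 2 * (m * (A * K + A) * (A * Y) + n * ((A * Y)\<^sup>2 - 2 * A * (A * K) + 2 * A\<^sup>2))"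
    unfolding U[symmetric] by algebra
  then have sum: "U * (s + r) = B"
    unfolding Y K unfolding A_def B_def U_def k_def by algebra
  have "(y\<^sup>2 + 1) * (z\<^sup>2 + 1) * ((s + t) * (r + t)) = 4 * (m\<^sup>2 * K + m * n * Y + n\<^sup>2)"
    using s r unfolding K_def Y_def by algebra
  then have "U * (s * r + t * (s + r) + t\<^sup>2) = 4 * A * (m\<^sup>2 * (A * K) + m * n * (A * Y) + n\<^sup>2 * A)"
    unfolding U[symmetric] by algebra
  then have prod: "U * (s * r) = C"
    using sum unfolding Y K unfolding A_def B_def U_def k_def C_def by algebra
  \<comment> \<open>Both arms end at the same \<open>w\<close>; subtracting the cross-multiplied sum
    relations eliminates it. As \<open>s - r\<close> is a multiple of \<open>y - z\<close> over
    \<open>U\<close>, the factor \<open>y - z\<close> finally cancels.\<close>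
  have "(s\<^sup>2 + 1) * (r\<^sup>2 + 1) * (y - z) = 2 * (s - r) * (m - n * (s + r) - m * (s * r))"
    using w by algebra
  moreover have "(s\<^sup>2 + 1) * (r\<^sup>2 + 1) = (s * r - 1)\<^sup>2 + (s + r)\<^sup>2" by algebra
  ultimately have "((U * (s * r) - U)\<^sup>2 + (U * (s + r))\<^sup>2) * (y - z)
     = 2 * (U * (s - r)) * (m * U - n * (U * (s + r)) - m * (U * (s * r)))"
    by algebra
  then have "((C - U)\<^sup>2 + B\<^sup>2) * (y - z) = 4 * (m * d - 2 * k) * A * (m * U - n * B - m * C) * (y - z)"
    unfolding diff sum prod by (simp add: algebra_simps)
  then have "(C - U)\<^sup>2 + B\<^sup>2 = 4 * (m * d - 2 * k) * A * (m * U - n * B - m * C)"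
    using \<open>y \<noteq> z\<close> by simp
  then have "d * hexpol m n d * A\<^sup>2 = 0"
    using closing_identity[of m d n t] unfolding A_def B_def U_def k_def C_def by simp
  then show ?thesis using nz by (auto simp: A_def)
qed

text \<open>The leading coefficient vanishes at an isotropic tangent: one neighbour is the line at
  infinity, and the other solves a linear equation.\<close>

lemma hedge_isotropic:
  assumes "j\<^sup>2 = -1"
  shows "hedge m n d j s = 0 \<longleftrightarrow> 2 * (m - j * n) * (s + j) = j * d"
proof -
  have "hedge m n d j s = j * (j * d - 2 * (m - j * n) * (s + j))"
    unfolding hedge_def using assms by algebra
  moreover have "j \<noteq> 0" using assms by auto
  ultimately show ?thesis by auto
qed

text \<open>The left-hand side is the denominator-free condition that the arms leaving the line at
  infinity through \<open>j\<close> and \<open>-j\<close> meet. It recovers the polynomial of the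
  generic case.\<close>

lemma hexpol_closing:
  assumes k: "k = m\<^sup>2 + n\<^sup>2"
  shows "4 * (m * d - 2 * k) * (4 * k - m * d) - d * (16 * k - 8 * m * d + d\<^sup>2) = - hexpol m n d"
  unfolding hexpol_def k by algebra

text \<open>\<open>s\<close> is the finite neighbour of \<open>j\<close>. For nonzero
  \<open>m - j * n\<close>, the factor \<open>4 * (m - j * n) - d\<close> vanishes exactly when
  \<open>s = j\<close>, where the orbit folds back.\<close>

lemma isotropic_factors:
  fixes j :: complex
  assumes j: "j\<^sup>2 = -1" and k: "k = m\<^sup>2 + n\<^sup>2" and s: "2 * (m - j * n) * (s + j) = j * d"
  shows "4 * (m - j * n)\<^sup>2 * (s\<^sup>2 + 1) = d * (4 * (m - j * n) - d)"
    and "2 * (m - j * n) * (m * s + n) = j * (m * d - 2 * k)"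
proof -
  have "4 * (m - j * n)\<^sup>2 * (s\<^sup>2 + 1) = (2 * (m - j * n) * (s + j)) * (2 * (m - j * n) * (s + j) - 4 * j * (m - j * n))"
    using j by algebra
  also have "\<dots> = d * (4 * (m - j * n) - d)" unfolding s using j by algebra
  finally show "4 * (m - j * n)\<^sup>2 * (s\<^sup>2 + 1) = d * (4 * (m - j * n) - d)" .
  have "2 * (m - j * n) * (m * s + n) = m * (2 * (m - j * n) * (s + j)) - 2 * j * k"
    unfolding k using j by algebra
  also have "\<dots> = j * (m * d - 2 * k)" unfolding s by algebra
  finally show "2 * (m - j * n) * (m * s + n) = j * (m * d - 2 * k)" .
qed

text \<open>Vieta at \<open>s\<close> with neighbours \<open>j\<close> and \<open>w\<close>, freed
  of \<open>s\<close> by the factor \<open>4 * (m - j * n)\<^sup>2\<close>.\<close>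

lemma isotropic_next:
  fixes j :: complex
  assumes j: "j\<^sup>2 = -1" and k: "k = m\<^sup>2 + n\<^sup>2" and s: "2 * (m - j * n) * (s + j) = j * d"
    and nz: "m - j * n \<noteq> 0"
  shows "(s\<^sup>2 + 1) * (w + j) = 2 * (m * s + n) \<longleftrightarrow>
    d * (4 * (m - j * n) - d) * (w + j) = 4 * (m - j * n) * j * (m * d - 2 * k)"
proof -
  note f = isotropic_factors[OF j k s]
  have "(s\<^sup>2 + 1) * (w + j) = 2 * (m * s + n) \<longleftrightarrow>
     4 * (m - j * n)\<^sup>2 * ((s\<^sup>2 + 1) * (w + j)) = 4 * (m - j * n)\<^sup>2 * (2 * (m * s + n))"
    using nz by simp
  also have "4 * (m - j * n)\<^sup>2 * ((s\<^sup>2 + 1) * (w + j)) = d * (4 * (m - j * n) - d) * (w + j)"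
    unfolding f(1)[symmetric] by (simp only: mult.assoc)
  also have "4 * (m - j * n)\<^sup>2 * (2 * (m * s + n)) = 4 * (m - j * n) * j * (m * d - 2 * k)"
    using f(2) by algebra
  finally show ?thesis .
qed

lemma hexpol_infinite:
  assumes j: "j\<^sup>2 = -1"
    and e: "hedge m n d j s = 0" "hedge m n d (-j) r = 0" "hedge m n d s w = 0" "hedge m n d r w = 0"
    and ne: "w \<noteq> j" "w \<noteq> -j"
    and nz: "m - j * n \<noteq> 0" "m + j * n \<noteq> 0"
  shows "hexpol m n d = 0"
proof -
  define k where "k = m\<^sup>2 + n\<^sup>2"
  have j': "(-j)\<^sup>2 = -1" and j0: "j \<noteq> 0" using j by auto
  have s: "2 * (m - j * n) * (s + j) = j * d"
    using e(1) hedge_isotropic[OF j] by simp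
  have r: "2 * (m - (-j) * n) * (r + -j) = (-j) * d"
    using e(2) hedge_isotropic[OF j', of m n d r] by simp
  have "(s\<^sup>2 + 1) * (w + j) = 2 * (m * s + n)"
    using e ne by (intro hedge_sum[of m n d]) (auto simp: hedge_commute[of _ _ _ s j])
  then have 1: "d * (4 * (m - j * n) - d) * (w + j) = 4 * (m - j * n) * j * (m * d - 2 * k)"
    using isotropic_next[OF j k_def s nz(1)] by simp
  have "(r\<^sup>2 + 1) * (w + -j) = 2 * (m * r + n)"
    using e ne by (intro hedge_sum[of m n d]) (auto simp: hedge_commute[of _ _ _ r "-j"])
  moreover have "m - (-j) * n \<noteq> 0" using nz(2) by simp
  ultimately have "d * (4 * (m - (-j) * n) - d) * (w + -j) = 4 * (m - (-j) * n) * (-j) * (m * d - 2 * k)"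
    using isotropic_next[OF j' k_def r] by blast
  then have 2: "d * (4 * (m + j * n) - d) * (w - j) = - 4 * (m + j * n) * j * (m * d - 2 * k)"
    by algebra
  \<comment> \<open>Subtracting the two expressions for \<open>w\<close> after cross-multiplication;
    \<open>(w + j) - (w - j) = 2 * j\<close> removes \<open>w\<close>.\<close>
  have "2 * j * (d * (4 * (m - j * n) - d) * (4 * (m + j * n) - d))
     = 4 * j * (m * d - 2 * k) * ((m - j * n) * (4 * (m + j * n) - d) + (m + j * n) * (4 * (m - j * n) - d))"
    using 1 2 by algebra
  then have "2 * j * (d * (16 * k - 8 * m * d + d\<^sup>2)) = 2 * j * (4 * (m * d - 2 * k) * (4 * k - m * d))"
    unfolding k_def using j by algebra
  then show ?thesis
    using j0 hexpol_closing[OF k_def, of d] by simp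
qed

text \<open>The linear equations at \<open>j\<close> and \<open>-j\<close> determine
  \<open>s\<close> and \<open>r\<close>; the last two inequalities in \<open>nz\<close> exclude the
  folds \<open>s = j\<close> and \<open>r = -j\<close>.\<close>

lemma hexagon_infinite:
  assumes j: "j\<^sup>2 = -1" and Q: "hexpol m n d = 0" and d: "d \<noteq> 0"
    and nz: "m - j * n \<noteq> 0" "m + j * n \<noteq> 0" "4 * (m - j * n) \<noteq> d" "4 * (m + j * n) \<noteq> d"
  obtains s w r where "hedge m n d j s = 0" "hedge m n d s w = 0" "hedge m n d w r = 0" "hedge m n d r (-j) = 0"
    "s \<noteq> -j" "r \<noteq> j" "s \<noteq> r" "w \<noteq> j" "w \<noteq> -j"
proof -
  define k where "k = m\<^sup>2 + n\<^sup>2"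
  have j': "(-j)\<^sup>2 = -1" and j0: "j \<noteq> 0" using j by auto
  have kf: "k = (m - j * n) * (m + j * n)" unfolding k_def using j by algebra
  define s where "s = -j + j * d / (2 * (m - j * n))"
  define r where "r = j - j * d / (2 * (m + j * n))"
  \<comment> \<open>\<open>w\<close> is solved for along the arm through \<open>j\<close>; the
    vanishing of \<open>hexpol\<close> makes it the end of the other arm too.\<close>
  define w where "w = -j + 4 * (m - j * n) * j * (m * d - 2 * k) / (d * (4 * (m - j * n) - d))"
  have s: "2 * (m - j * n) * (s + j) = j * d"
    unfolding s_def using nz by (simp add: field_simps)
  have r: "2 * (m - (-j) * n) * (r + -j) = (-j) * d"
  proof -
    have "2 * (m + j * n) \<noteq> 0" using nz(2) by (simp only: mult_eq_0_iff) simp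
    then have "2 * (m + j * n) * (j * d / (2 * (m + j * n))) = j * d" by simp
    then show ?thesis unfolding r_def by algebra
  qed
  have 1: "d * (4 * (m - j * n) - d) * (w + j) = 4 * (m - j * n) * j * (m * d - 2 * k)"
    unfolding w_def using nz d by simp
  have "4 * (m * d - 2 * k) * (4 * k - m * d) = d * (16 * k - 8 * m * d + d\<^sup>2)"
    using hexpol_closing[OF k_def, of d] Q by simp
  then have "(4 * (m - j * n) - d) * (d * (4 * (m + j * n) - d) * (w - j)) = (4 * (m - j * n) - d) * (- 4 * (m + j * n) * j * (m * d - 2 * k))"
    using 1 kf j by algebra
  moreover have "4 * (m - j * n) - d \<noteq> 0" using nz by simp
  ultimately have "d * (4 * (m + j * n) - d) * (w - j) = - 4 * (m + j * n) * j * (m * d - 2 * k)"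
    using mult_left_cancel by blast
  then have 2: "d * (4 * (m + j * n) - d) * (w + -j) = 4 * (m - (-j) * n) * (-j) * (m * d - 2 * k)"
    by algebra
  have es: "hedge m n d j s = 0" using s hedge_isotropic[OF j] by simp
  have er: "hedge m n d (-j) r = 0" using r hedge_isotropic[OF j', of m n d r] by simp
  have w1: "(s\<^sup>2 + 1) * (w + j) = 2 * (m * s + n)"
    using isotropic_next[OF j k_def s nz(1)] 1 by simp
  have w2: "(r\<^sup>2 + 1) * (w + -j) = 2 * (m * r + n)"
  proof -
    have "m - (-j) * n \<noteq> 0" using nz(2) by simp
    moreover have "d * (4 * (m - (-j) * n) - d) * (w + -j) = 4 * (m - (-j) * n) * (-j) * (m * d - 2 * k)"
      using 2 by simp
    ultimately show ?thesis using isotropic_next[OF j' k_def r] by blast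
  qed
  \<comment> \<open>Vieta in reverse: \<open>j\<close> is already a root of the quadratic at
    \<open>s\<close>, so the sum relation makes \<open>w\<close> a root.\<close>
  have "hedge m n d s w = hedge m n d j s + (w - j) * ((s\<^sup>2 + 1) * (w + j) - 2 * (m * s + n))"
    unfolding hedge_def by algebra
  then have sw: "hedge m n d s w = 0" using w1 es by simp
  have "hedge m n d w r = hedge m n d (-j) r + (w + j) * ((r\<^sup>2 + 1) * (w + -j) - 2 * (m * r + n))"
    unfolding hedge_def by algebra
  then have wr: "hedge m n d w r = 0" using w2 er by simp
  have "k \<noteq> 0" using kf nz by simp
  \<comment> \<open>Each of the coincidences \<open>w = j\<close>, \<open>w = -j\<close>,
    \<open>s = r\<close> would force \<open>m * d = 2 * k\<close>.\<close>
  have four: "m * d - 2 * k \<noteq> 0"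
  proof
    assume 0: "m * d - 2 * k = 0"
    then have "d * (16 * k - 8 * m * d + d\<^sup>2) = 0"
      using hexpol_closing[OF k_def, of d] Q by simp
    then have "16 * k - 8 * m * d + d\<^sup>2 = 0" using d by simp
    moreover have "16 * k - 8 * m * d + d\<^sup>2 = (4 * (m - j * n) - d) * (4 * (m + j * n) - d)"
      unfolding kf by algebra
    ultimately show False using nz by simp
  qed
  have "s \<noteq> -j" using s j0 d by auto
  moreover have "r \<noteq> j" using r j0 d by auto
  moreover have "w \<noteq> -j" using 1 four nz j0 by auto
  moreover have "w \<noteq> j"
  proof
    assume "w = j"
    then have "4 * (m - (-j) * n) * (-j) * (m * d - 2 * k) = 0" using 2 by simp
    then show False using four nz(2) j0 by (simp only: mult_eq_0_iff) simp
  qed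
  moreover have "4 * k * (s - r) = 4 * j * (m * d - 2 * k)" using s r j kf by algebra
  then have "s \<noteq> r" using four j0 by auto
  moreover have "hedge m n d r (-j) = 0" using er hedge_commute by metis
  ultimately show ?thesis using that es sw wr by blast
qed

text \<open>The path \<open>z, t, y\<close> continues with \<open>-z\<close>, hence with its own
  image under negation, and closes after six steps.\<close>

lemma hexagon_special_aux:
  fixes t y z m :: complex
  assumes h: "hedge m 0 (4*m) t y = 0" "hedge m 0 (4*m) t z = 0" "y \<noteq> z" and t: "t\<^sup>2 + 1 \<noteq> 0"
  shows "hedge m 0 (4*m) y (-z) = 0"
proof -
  have a: "(t\<^sup>2 + 1) * (y + z) = 2 * (m * t)" "(t\<^sup>2 + 1) * (y * z) = t\<^sup>2 + 1 - 2 * m"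
    using hedge_sum[OF h] hedge_prod[OF h] by algebra+
  have "(t\<^sup>2 + 1)\<^sup>2 * hedge m 0 (4*m) y (-z) = 0"
    using a unfolding hedge_def by algebra
  then show ?thesis using t by simp
qed

text \<open>
  For \<open>n = 0\<close>, \<open>d = 4 m\<close> the correspondence is \<open>(s\<^sup>2 + 1) (t\<^sup>2 + 1) = 2 m (s t + 1)\<close>, and opposite sides
  of a hexagon are exchanged by \<open>s \<mapsto> - s\<close>.
\<close>

lemma hexagon_special:
  fixes m :: complex
  assumes m: "m \<noteq> 0"
  obtains t y z where "hedge m 0 (4*m) t y = 0" "hedge m 0 (4*m) t z = 0" "hedge m 0 (4*m) y (-z) = 0"
    "distinct [t, y, -z, -t, -y, z]"
proof -
  note witness = that
  \<comment> \<open>The conditions exclude in turn an isotropic \<open>t\<close>,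
    \<open>t = -t\<close>, \<open>t\<close> adjacent to itself or to \<open>0\<close>,
    \<open>t\<close> adjacent to \<open>-t\<close>, and a double neighbour
    \<open>y = z\<close>.\<close>
  have *: thesis
    if A: "A = t\<^sup>2 + 1" "A \<noteq> 0" "t \<noteq> 0" "A \<noteq> 2 * m" "A\<^sup>2 \<noteq> 2 * m * (2 - A)" "(A - m)\<^sup>2 \<noteq> m\<^sup>2 * A" for A t
  proof -
    \<comment> \<open>\<open>g\<^sup>2\<close> is a quarter of the discriminant of the quadratic
      whose roots are the neighbours of \<open>t\<close>.\<close>
    define g where "g = csqrt (m\<^sup>2 * A - (A - m)\<^sup>2)"
    define y where "y = (m * t + g) / A"
    define z where "z = (m * t - g) / A"
    have g: "g\<^sup>2 = m\<^sup>2 * A - (A - m)\<^sup>2" by (simp add: g_def)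
    have y: "A * y = m * t + g" and z: "A * z = m * t - g" using A by (simp_all add: y_def z_def)
    have "A * hedge m 0 (4*m) t y = 0" using y g unfolding hedge_def A(1) by algebra
    then have hy: "hedge m 0 (4*m) t y = 0" using A by simp
    have "A * hedge m 0 (4*m) t z = 0" using z g unfolding hedge_def A(1) by algebra
    then have hz: "hedge m 0 (4*m) t z = 0" using A by simp
    have g0: "g \<noteq> 0" using g A by auto
    have "A * (y - z) = 2 * g" using y z by algebra
    then have yz: "y \<noteq> z" using g0 by auto
    have hyz: "hedge m 0 (4*m) y (-z) = 0"
      using hexagon_special_aux[OF hy hz yz] A by simp
    have "A * (y + z) = 2 * m * t" using y z by algebra
    then have yz': "y \<noteq> -z" using m A by auto
    have ne: "u \<noteq> 0" "u \<noteq> t" "u \<noteq> -t" if "hedge m 0 (4*m) t u = 0" for u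
    proof -
      show "u \<noteq> 0" using that A by (auto simp: hedge_def)
      have "hedge m 0 (4*m) t t = A * (A - 2 * m)" "hedge m 0 (4*m) t (-t) = A\<^sup>2 - 2 * m * (2 - A)"
        unfolding hedge_def A(1) by algebra+
      then show "u \<noteq> t" "u \<noteq> -t" using that A by auto
    qed
    have mt: "x \<noteq> -x" if "x \<noteq> 0" for x :: complex using that by simp
    have "distinct [t, y, -z, -t, -y, z]"
      using ne[OF hy] ne[OF hz] yz yz' A(3)
      by (auto simp: equation_minus_iff minus_equation_iff mt)
    then show thesis using witness hy hz hyz by blast
  qed
  \<comment> \<open>The choice \<open>A = m\<close> fails only for \<open>m = 1\<close>, where
    \<open>t = 0\<close>, and for \<open>m = 4/3\<close>, where \<open>t\<close> is adjacent to
    \<open>-t\<close>; there \<open>t = 2\<close> serves.\<close>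
  consider "m = 1" | "m = 4/3" | "m \<noteq> 1" "m \<noteq> 4/3" by blast
  then show thesis
  proof cases
    case 1
    show thesis by (rule *[of 5 2]) (simp_all add: 1)
  next
    case 2
    show thesis by (rule *[of 5 2]) (simp_all add: 2 power2_eq_square)
  next
    case 3
    show thesis
    proof (rule *[of m "csqrt (m - 1)"])
      show "m\<^sup>2 \<noteq> 2 * m * (2 - m)"
      proof
        assume "m\<^sup>2 = 2 * m * (2 - m)"
        then have "m * (3 * m - 4) = 0" by algebra
        then show False using m 3 by (auto simp: field_simps)
      qed
    qed (use m 3 in auto)
  qed
qed

section \<open>Tangents of the parabola and vertices\<close>

text \<open>
  \<open>vtx p s t\<close> is the intersection of the tangents \<open>s\<close> and \<open>t\<close> (the point of tangency for \<open>s = t\<close>),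
  and \<open>vtx_inf s\<close> is the intersection of the tangent \<open>s\<close> with the line at infinity.
\<close>

definition vtx :: "complex \<Rightarrow> complex \<Rightarrow> complex \<Rightarrow> complex^3" where
  "vtx p s t = vector [p * (s * t - 1), p * (s + t), 2]"

definition vtx_inf :: "complex \<Rightarrow> complex^3" where
  "vtx_inf s = vector [s, 1, 0]"

definition on_tangent :: "complex \<Rightarrow> complex \<Rightarrow> complex^3 \<Rightarrow> bool" where
  "on_tangent p s v \<longleftrightarrow> p * (s\<^sup>2 + 1) * v$3 + 2 * v$1 = 2 * s * v$2"

lemma vec3_eq_iff: "(u::complex^3) = v \<longleftrightarrow> u$1 = v$1 \<and> u$2 = v$2 \<and> u$3 = v$3"
  by (simp add: vec_eq_iff forall_3)

lemma vtx_nth [simp]: "vtx p s t $ 1 = p * (s * t - 1)" "vtx p s t $ 2 = p * (s + t)" "vtx p s t $ 3 = 2"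
  by (simp_all add: vtx_def)

lemma vtx_inf_nth [simp]: "vtx_inf s $ 1 = s" "vtx_inf s $ 2 = 1" "vtx_inf s $ 3 = 0"
  by (simp_all add: vtx_inf_def)

lemma vtx_nonzero [simp]: "vtx p s t \<noteq> 0" "vtx_inf s \<noteq> 0"
  by (simp_all add: vec3_eq_iff)

section \<open>The two conics and equality of projective points\<close>

lemma conic_form_unit_circle:
  "conic_form (unit_circle a b) u v =
     u$1 * v$1 + u$2 * v$2 - a * (u$1 * v$3 + u$3 * v$1) - b * (u$2 * v$3 + u$3 * v$2)
       + (a\<^sup>2 + b\<^sup>2 - 1) * u$3 * v$3"
  by (simp add: conic_form_def unit_circle_def sum_3 algebra_simps)

lemma conic_form_parabola:
  "conic_form (parabola p) u v =
     u$2 * v$2 - p * (u$1 * v$3 + u$3 * v$1) - (of_real p)\<^sup>2 * u$3 * v$3"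
  by (simp add: conic_form_def parabola_def sum_3 algebra_simps)

lemma smooth_unit_circle: "smooth_conic (unit_circle a b)"
proof -
  have "transpose (unit_circle a b) = unit_circle a b"
    by (simp add: vec_eq_iff forall_3 transpose_def unit_circle_def)
  moreover have "u = 0" if "unit_circle a b *v u = 0" for u
  proof -
    have 1: "u$1 = a * u$3" "u$2 = b * u$3" "(a\<^sup>2 + b\<^sup>2 - 1) * u$3 = a * u$1 + b * u$2"
      using that by (simp_all add: vec3_eq_iff matrix_vector_mult_def sum_3 unit_circle_def algebra_simps)
    have "u$3 = 0" using 1(3) unfolding 1(1,2) by (simp add: algebra_simps power2_eq_square)
    then show ?thesis using 1 by (simp add: vec3_eq_iff)
  qed
  ultimately show ?thesis by (auto simp: smooth_conic_def on_conic_def)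
qed

lemma smooth_parabola:
  assumes "p \<noteq> 0" shows "smooth_conic (parabola p)"
proof -
  have "transpose (parabola p) = parabola p"
    by (simp add: vec_eq_iff forall_3 transpose_def parabola_def)
  moreover have "u = 0" if "parabola p *v u = 0" for u
  proof -
    have "u$3 = 0" "u$2 = 0" "p * u$1 = 0"
      using that assms by (auto simp: vec3_eq_iff matrix_vector_mult_def sum_3 parabola_def)
    then show ?thesis using assms by (simp add: vec3_eq_iff)
  qed
  ultimately show ?thesis by (auto simp: smooth_conic_def on_conic_def)
qed

lemma same_point_sym: "same_point u v \<longleftrightarrow> same_point v u"
proof -
  have "same_point v u" if "same_point u v" for u v
  proof -
    from that obtain c where "c \<noteq> 0" "u = c *s v" by (auto simp: same_point_def)
    then have "v = inverse c *s u" by (simp add: vec_eq_iff)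
    then show ?thesis using \<open>c \<noteq> 0\<close> unfolding same_point_def by (metis inverse_nonzero_iff_nonzero)
  qed
  then show ?thesis by blast
qed

lemma same_point_trans: "same_point u v \<Longrightarrow> same_point v w \<Longrightarrow> same_point u w"
  unfolding same_point_def by (metis mult_eq_0_iff vector_smult_assoc)

lemma on_conic_same:
  assumes "same_point u v" shows "on_conic A u \<longleftrightarrow> on_conic A v"
proof -
  obtain c where c: "c \<noteq> 0" "u = c *s v" using assms by (auto simp: same_point_def)
  have "conic_form A u u = c\<^sup>2 * conic_form A v v"
    unfolding c by (simp add: conic_form_def sum_3 algebra_simps power2_eq_square)
  then show ?thesis using c by (simp add: on_conic_def)
qed

text \<open>The third coordinate \<open>2\<close> fixes the scalar to \<open>1\<close>, and sum and
  product recover the unordered pair of tangents.\<close>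

lemma same_point_vtx:
  assumes "p \<noteq> 0"
  shows "same_point (vtx p s t) (vtx p s' t') \<longleftrightarrow> s = s' \<and> t = t' \<or> s = t' \<and> t = s'"
proof
  assume "same_point (vtx p s t) (vtx p s' t')"
  then obtain c where c: "vtx p s t = c *s vtx p s' t'" by (auto simp: same_point_def)
  then have "c = 1" by (auto simp: vec3_eq_iff)
  with c have 1: "s * t = s' * t'" "s + t = s' + t'" using assms by (auto simp: vec3_eq_iff)
  then have "(s - s') * (s - t') = 0" by algebra
  then show "s = s' \<and> t = t' \<or> s = t' \<and> t = s'" using 1 by auto
next
  assume "s = s' \<and> t = t' \<or> s = t' \<and> t = s'"
  then show "same_point (vtx p s t) (vtx p s' t')"
    by (auto simp: same_point_def vec3_eq_iff intro!: exI[of _ 1])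
qed

lemma not_same_point_inf [simp]:
  "\<not> same_point (vtx p s t) (vtx_inf u)" "\<not> same_point (vtx_inf u) (vtx p s t)"
  by (auto simp: same_point_def vec3_eq_iff)

lemma same_point_vtx_inf: "same_point (vtx_inf u) (vtx_inf w) \<longleftrightarrow> u = w"
  by (auto simp: same_point_def vec3_eq_iff)

lemma on_conic_parabola_finite:
  assumes "p \<noteq> 0" "on_conic (parabola p) q" "q$3 \<noteq> 0"
  obtains s where "\<And>v. conic_form (parabola p) q v = 0 \<longleftrightarrow> on_tangent p s v"
proof
  fix v
  \<comment> \<open>The rational parameter of the parabola: \<open>q\<close> is proportional to
    \<open>vtx p s s\<close>.\<close>
  define s where "s = q$2 / (p * q$3)"
  have s: "q$2 = p * q$3 * s" using assms by (simp add: s_def)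
  have "q$2 * q$2 - p * (q$1 * q$3 + q$3 * q$1) - (of_real p)\<^sup>2 * q$3 * q$3 = 0"
    using assms by (simp add: on_conic_def conic_form_parabola)
  then have "p * q$3 * (2 * q$1) = p * q$3 * (p * q$3 * (s\<^sup>2 - 1))"
    unfolding s by algebra
  then have q1: "2 * q$1 = p * q$3 * (s\<^sup>2 - 1)" using assms by simp
  have "2 * conic_form (parabola p) q v = - (p * q$3) * (p * (s\<^sup>2 + 1) * v$3 + 2 * v$1 - 2 * s * v$2)"
    unfolding conic_form_parabola s using q1 by algebra
  then have "conic_form (parabola p) q v = 0 \<longleftrightarrow> p * (s\<^sup>2 + 1) * v$3 + 2 * v$1 - 2 * s * v$2 = 0"
    using assms by (metis mult_eq_0_iff neg_equal_0_iff_equal zero_neq_numeral of_real_eq_0_iff)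
  then show "conic_form (parabola p) q v = 0 \<longleftrightarrow> on_tangent p (q$2 / (p * q$3)) v"
    by (simp add: on_tangent_def s_def)
qed

text \<open>The only point of the parabola at infinity is \<open>(1 : 0 : 0)\<close>, where it
  touches the line at infinity.\<close>

lemma on_conic_parabola_infinite:
  assumes "p \<noteq> 0" "on_conic (parabola p) q" "q$3 = 0" "conic_form (parabola p) q v = 0"
  shows "v$3 = 0"
  using assms by (auto simp: on_conic_def conic_form_parabola vec3_eq_iff)

lemma tangency_point: 
  assumes "p \<noteq> 0" 
  shows "on_conic (parabola p) (vtx p s s)"
    "conic_form (parabola p) (vtx p s s) v = 0 \<longleftrightarrow> on_tangent p s v"
proof -
  show "on_conic (parabola p) (vtx p s s)"
    by (simp add: on_conic_def conic_form_parabola) algebra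
  have "conic_form (parabola p) (vtx p s s) v = - p * (p * (s\<^sup>2 + 1) * v$3 + 2 * v$1 - 2 * s * v$2)"
    by (simp add: conic_form_parabola) algebra
  then show "conic_form (parabola p) (vtx p s s) v = 0 \<longleftrightarrow> on_tangent p s v"
    using assms by (simp add: on_tangent_def)
qed

lemma join_tangentI:
  assumes "p \<noteq> 0" "on_tangent p s u" "on_tangent p s v"
  shows "join_tangent (parabola p) u v"
  unfolding join_tangent_def using tangency_point[OF assms(1)] assms by blast

lemma join_tangent_inf: "join_tangent (parabola p) (vtx_inf s) (vtx_inf t)"
  unfolding join_tangent_def
  by (rule exI[of _ "vector [1, 0, 0]"]) (simp add: on_conic_def conic_form_parabola vec3_eq_iff)

lemma on_tangent_vtx [simp]: "on_tangent p s (vtx p s t)" "on_tangent p t (vtx p s t)"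
  "on_tangent p s (vtx_inf s)"
  by (simp_all add: on_tangent_def algebra_simps power2_eq_square)

lemma on_two_tangents:
  assumes "p \<noteq> 0" "on_tangent p s v" "on_tangent p t v" "s \<noteq> t" "v \<noteq> 0"
  shows "same_point v (vtx p s t)"
proof -
  have "(s - t) * (p * (s + t) * v$3) = (s - t) * (2 * v$2)"
    using assms(2,3) unfolding on_tangent_def by algebra
  then have 2: "p * (s + t) * v$3 = 2 * v$2" using assms by simp
  then have 1: "2 * v$1 = p * (s * t - 1) * v$3"
    using assms(2) unfolding on_tangent_def by algebra
  have "v$3 \<noteq> 0" using 1 2 assms by (auto simp: vec3_eq_iff)
  then show ?thesis unfolding same_point_def using 1 2
    by (intro exI[of _ "v$3 / 2"]) (auto simp: vec3_eq_iff algebra_simps)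
qed

section \<open>A circle and a parabola in nondegenerate position\<close>

locale circle_parabola =
  fixes a b p :: real
  assumes p: "p \<noteq> 0" and not_unit: "a\<^sup>2 + b\<^sup>2 \<noteq> 1" and not_origin: "a \<noteq> 0 \<or> b \<noteq> 0"
begin

definition m :: complex where "m = 2 * a / p"
definition n :: complex where "n = 2 * b / p"
definition d :: complex where "d = 4 * (1 - a\<^sup>2 - b\<^sup>2) / p\<^sup>2"

lemma params:
  "of_real p * m = 2 * of_real a" "of_real p * n = 2 * of_real b"
  "(of_real p)\<^sup>2 * d = 4 * (1 - (of_real a)\<^sup>2 - (of_real b)\<^sup>2)"
  using p by (simp_all add: m_def n_def d_def)

text \<open>The isotropic tangents meet at the focus, and \<open>-d\<close> is the value of the
  correspondence there; \<open>not_unit\<close> keeps the circle off the focus.\<close>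

lemma d_nonzero: "d \<noteq> 0"
proof -
  have "d = of_real (4 * (1 - a\<^sup>2 - b\<^sup>2) / p\<^sup>2)" by (simp add: d_def)
  moreover have "4 * (1 - a\<^sup>2 - b\<^sup>2) / p\<^sup>2 \<noteq> 0" using p not_unit by auto
  ultimately show ?thesis using of_real_eq_0_iff by metis
qed

text \<open>The product of the two factors is
  \<open>4 * (a\<^sup>2 + b\<^sup>2) / p\<^sup>2\<close>, nonzero for a real centre other than the
  focus.\<close>

lemma isotropic_nonzero:
  assumes "j\<^sup>2 = (-1::complex)" shows "m - j * n \<noteq> 0" "m + j * n \<noteq> 0"
proof -
  have "(m - j * n) * (m + j * n) = m\<^sup>2 + n\<^sup>2" using assms by algebra
  moreover have "(of_real p)\<^sup>2 * (m\<^sup>2 + n\<^sup>2) = 4 * of_real (a\<^sup>2 + b\<^sup>2)"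
    unfolding of_real_add of_real_power using params by algebra
  moreover have "a\<^sup>2 + b\<^sup>2 \<noteq> 0" using not_origin by (simp add: sum_power2_eq_zero_iff)
  ultimately show "m - j * n \<noteq> 0" "m + j * n \<noteq> 0" using p
    by (metis mult_eq_0_iff of_real_eq_0_iff zero_neq_numeral zero_eq_power2)+
qed

lemma on_circle_vtx: "on_conic (unit_circle a b) (vtx p s t) \<longleftrightarrow> hedge m n d s t = 0"
proof -
  have "conic_form (unit_circle a b) (vtx p s t) (vtx p s t) = (of_real p)\<^sup>2 * hedge m n d s t"
    unfolding conic_form_unit_circle vtx_nth hedge_def using params by algebra
  then show ?thesis using p by (simp add: on_conic_def)
qed

lemma on_circle_inf: "on_conic (unit_circle a b) (vtx_inf s) \<longleftrightarrow> s\<^sup>2 = -1"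
  by (simp add: on_conic_def conic_form_unit_circle power2_eq_square eq_neg_iff_add_eq_0)

end

section \<open>Poncelet hexagons\<close>

text \<open>The product of the pairwise determinants is, up to sign, the determinant of the linear
  system for the coefficients.\<close>

lemma binary_quadratic_three_zeros:
  fixes \<alpha> \<beta> \<gamma> :: "'a::idom"
  assumes "\<alpha> * x\<^sup>2 + \<beta> * x * u + \<gamma> * u\<^sup>2 = 0" "\<alpha> * y\<^sup>2 + \<beta> * y * v + \<gamma> * v\<^sup>2 = 0"
    "\<alpha> * z\<^sup>2 + \<beta> * z * w + \<gamma> * w\<^sup>2 = 0"
    and "x * v \<noteq> y * u" "x * w \<noteq> z * u" "y * w \<noteq> z * v"
  shows "\<alpha> = 0 \<and> \<beta> = 0"
proof -
  have "\<alpha> * ((x * v - y * u) * (x * w - z * u) * (y * w - z * v)) = 0"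
    "\<beta> * ((x * v - y * u) * (x * w - z * u) * (y * w - z * v)) = 0"
    using assms(1-3) by algebra+
  then show ?thesis using assms(4-6) by simp
qed

text \<open>On a finite tangent the first coordinate is linear in the other two, so their ratio is a
  projective coordinate on the line.\<close>

lemma on_tangent_same_point:
  assumes "on_tangent p s u" "on_tangent p s v" "u \<noteq> 0" "v \<noteq> 0" "u$2 * v$3 = v$2 * u$3"
  shows "same_point u v"
proof (cases "u$3 = 0")
  case True
  then have "u$2 \<noteq> 0" using assms by (auto simp: on_tangent_def vec3_eq_iff)
  then have "v$3 = 0" using True assms by simp
  moreover from this have "v$2 \<noteq> 0" using assms by (auto simp: on_tangent_def vec3_eq_iff)
  ultimately show ?thesis using assms True \<open>u$2 \<noteq> 0\<close>
    by (auto simp: same_point_def vec3_eq_iff on_tangent_def intro!: exI[of _ "u$2 / v$2"])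
next
  case False
  have v3: "v$3 \<noteq> 0"
  proof
    assume "v$3 = 0"
    then have "v$2 = 0" using assms False by simp
    then show False using assms \<open>v$3 = 0\<close> by (auto simp: on_tangent_def vec3_eq_iff)
  qed
  have u: "2 * u$1 = 2 * s * u$2 - p * (s\<^sup>2 + 1) * u$3" and v: "2 * v$1 = 2 * s * v$2 - p * (s\<^sup>2 + 1) * v$3"
    using assms(1,2) unfolding on_tangent_def by algebra+
  have "2 * (u$1 * v$3) = 2 * (v$1 * u$3)" using u v assms(5) by algebra
  then have "u$1 * v$3 = v$1 * u$3" by simp
  then show ?thesis using assms False v3
    by (auto simp: same_point_def vec3_eq_iff field_simps intro!: exI[of _ "u$3 / v$3"])
qed

lemma join_tangent_cases:
  assumes "p \<noteq> 0" "join_tangent (parabola p) u v"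
  shows "(\<exists>s. on_tangent p s u \<and> on_tangent p s v) \<or> u$3 = 0 \<and> v$3 = 0"
proof -
  obtain q where q: "on_conic (parabola p) q" "conic_form (parabola p) q u = 0" "conic_form (parabola p) q v = 0"
    using assms(2) by (auto simp: join_tangent_def)
  show ?thesis
  proof (cases "q$3 = 0")
    case True
    then show ?thesis using on_conic_parabola_infinite[OF assms(1) q(1)] q by auto
  next
    case False
    then show ?thesis using on_conic_parabola_finite[OF assms(1) q(1)] q by metis
  qed
qed

text \<open>Used to move a side at infinity between vertices \<open>0\<close> and
  \<open>1\<close>.\<close>

lemma poncelet_polygon_rotate:
  assumes "poncelet_polygon n C1 C2 v" 
  shows "poncelet_polygon n C1 C2 (\<lambda>i. v ((k + i) mod n))"
proof (cases "n = 0")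
  case True
  then show ?thesis by (simp add: poncelet_polygon_def)
next
  case False
  have less: "(k + i) mod n \<noteq> (k + j) mod n" if "i < j" "j < n" for i j
  proof
    assume "(k + i) mod n = (k + j) mod n"
    then have "n dvd j - i" using that mod_eq_dvd_iff_nat[of "k + i" "k + j" n] by simp
    then show False using that by (auto dest: dvd_imp_le)
  qed
  have "(k + i) mod n \<noteq> (k + j) mod n" if "i < n" "j < n" "i \<noteq> j" for i j
    using less[of i j] less[of j i] that by (metis nat_neq_iff)
  moreover have "(k + Suc i mod n) mod n = Suc ((k + i) mod n) mod n" for i
    by (simp add: mod_simps)
  ultimately show ?thesis using assms False by (simp add: poncelet_polygon_def)
qed

lemma poncelet_hexagonI:
  assumes "\<forall>v \<in> set [v0, v1, v2, v3, v4, v5]. on_conic C1 v"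
    and "sorted_wrt (\<lambda>u v. \<not> same_point u v) [v0, v1, v2, v3, v4, v5]"
    and "join_tangent C2 v0 v1" "join_tangent C2 v1 v2" "join_tangent C2 v2 v3"
      "join_tangent C2 v3 v4" "join_tangent C2 v4 v5" "join_tangent C2 v5 v0"
  shows "poncelet_polygon 6 C1 C2 ((!) [v0, v1, v2, v3, v4, v5])"
proof -
  have six: "(\<forall>i<6. P i) \<longleftrightarrow> P 0 \<and> P 1 \<and> P 2 \<and> P 3 \<and> P 4 \<and> P (5::nat)" for P
    by (auto simp: numeral_eq_Suc All_less_Suc)
  show ?thesis
    using assms unfolding poncelet_polygon_def six by (simp add: same_point_sym)
qed

section \<open>From hexagons to the correspondence and back\<close>

context circle_parabola
begin

text \<open>On the tangent the circle becomes a binary quadratic form. Three zeros give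
  \<open>\<alpha> = 0\<close>, so \<open>s\<close> is isotropic, and \<open>\<beta> = 0\<close>,
  which then contradicts \<open>isotropic_nonzero\<close>.\<close>

lemma no_three_collinear:
  assumes "on_tangent p s u" "on_tangent p s v" "on_tangent p s w"
    and "on_conic (unit_circle a b) u" "on_conic (unit_circle a b) v" "on_conic (unit_circle a b) w"
    and "\<not> same_point u v" "\<not> same_point u w" "\<not> same_point v w"
  shows False
proof -
  define \<alpha> where "\<alpha> = 4 * (s\<^sup>2 + 1)"
  define \<beta> where "\<beta> = - 4 * s * p * (s\<^sup>2 + 1) - 8 * (a * s + b)"
  define \<gamma> where "\<gamma> = (of_real p)\<^sup>2 * (s\<^sup>2 + 1)\<^sup>2 + 4 * a * p * (s\<^sup>2 + 1)
    + 4 * ((of_real a)\<^sup>2 + (of_real b)\<^sup>2 - 1)"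
  have eq: "\<alpha> * (u$2)\<^sup>2 + \<beta> * u$2 * u$3 + \<gamma> * (u$3)\<^sup>2 = 0"
    if "on_tangent p s u" "on_conic (unit_circle a b) u" for u
  proof -
    have u: "2 * u$1 = 2 * s * u$2 - of_real p * (s\<^sup>2 + 1) * u$3"
      using that unfolding on_tangent_def by algebra
    have "4 * conic_form (unit_circle a b) u u = \<alpha> * (u$2)\<^sup>2 + \<beta> * u$2 * u$3 + \<gamma> * (u$3)\<^sup>2"
      unfolding conic_form_unit_circle \<alpha>_def \<beta>_def \<gamma>_def of_real_mult of_real_numeral using u by algebra
    then show ?thesis using that by (simp add: on_conic_def)
  qed
  have nz: "u \<noteq> 0" "v \<noteq> 0" "w \<noteq> 0" using assms by (auto simp: on_conic_def)
  have "\<alpha> = 0 \<and> \<beta> = 0"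
    by (rule binary_quadratic_three_zeros[OF eq[of u] eq[of v] eq[of w]])
       (use assms nz on_tangent_same_point in \<open>blast+\<close>)
  then have s: "s\<^sup>2 + 1 = 0" unfolding \<alpha>_def by (metis mult_eq_0_iff zero_neq_numeral)
  have "\<beta> = 0" using \<open>\<alpha> = 0 \<and> \<beta> = 0\<close> ..
  then have "8 * (a * s + b) = 0" using s unfolding \<beta>_def by algebra
  then have "a * s + b = 0" by (metis mult_eq_0_iff zero_neq_numeral)
  have "of_real p * (s * (m - s * n)) = 2 * (a * s + b)"
    using params s by algebra
  then have "s * (m - s * n) = 0" using p \<open>a * s + b = 0\<close> by simp
  moreover have "s\<^sup>2 = -1" using s by algebra
  ultimately show False using isotropic_nonzero[of s] by auto
qed

lemma vertex_of_two_sides: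
  assumes "on_conic (unit_circle a b) u" "on_conic (unit_circle a b) v" "on_conic (unit_circle a b) w"
    and "\<not> same_point u v" "\<not> same_point u w" "\<not> same_point v w"
    and "on_tangent p s u" "on_tangent p s v" "on_tangent p t v" "on_tangent p t w"
  shows "same_point v (vtx p s t) \<and> hedge m n d s t = 0"
proof -
  have "s \<noteq> t" using no_three_collinear assms by blast
  moreover have "v \<noteq> 0" using assms by (simp add: on_conic_def)
  ultimately have "same_point v (vtx p s t)" using on_two_tangents assms p by simp
  then show ?thesis using on_conic_same assms on_circle_vtx by blast
qed

text \<open>Supplies the inequality of the two neighbours of a side that Vieta requires.\<close>

lemma consecutive_vertices:
  assumes "same_point v (vtx p s t)" "same_point w (vtx p t r)" "\<not> same_point v w"
  shows "s \<noteq> r"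
proof
  assume "s = r"
  then have "same_point (vtx p s t) (vtx p t r)" using same_point_vtx p by simp
  then show False using assms same_point_sym same_point_trans by blast
qed

lemma isotropic_point:
  assumes "on_conic (unit_circle a b) v" "v$3 = 0"
  obtains j where "j\<^sup>2 = -1" "same_point v (vtx_inf j)"
proof -
  have v: "v$1 * v$1 + v$2 * v$2 = 0" using assms by (simp add: on_conic_def conic_form_unit_circle)
  then have v2: "v$2 \<noteq> 0" using assms by (auto simp: on_conic_def vec3_eq_iff)
  have "(v$1 / v$2)\<^sup>2 = -1" using v v2 by (simp add: field_simps power2_eq_square eq_neg_iff_add_eq_0)
  moreover have "same_point v (vtx_inf (v$1 / v$2))" unfolding same_point_def
    by (rule exI[of _ "v$2"]) (use v2 assms in \<open>simp add: vec3_eq_iff\<close>)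
  ultimately show ?thesis using that by blast
qed

lemma hexagon_necessary:
  assumes "poncelet_polygon 6 (unit_circle a b) (parabola p) v"
  shows "hexpol m n d = 0"
proof (cases "\<exists>k<6. v k $ 3 = 0 \<and> v (Suc k mod 6) $ 3 = 0")
  case False
  have on: "on_conic (unit_circle a b) (v i)" if "i < 6" for i
    using assms that by (simp add: poncelet_polygon_def)
  have ne: "\<not> same_point (v i) (v j)" if "i < 6" "j < 6" "i \<noteq> j" for i j
    using assms that by (simp add: poncelet_polygon_def)
  have "\<forall>i\<in>{..<6}. \<exists>s. on_tangent p s (v i) \<and> on_tangent p s (v (Suc i mod 6))"
    using assms False join_tangent_cases[OF p] unfolding poncelet_polygon_def by blast
  then obtain s where s: "\<And>i. i < 6 \<Longrightarrow> on_tangent p (s i) (v i) \<and> on_tangent p (s i) (v (Suc i mod 6))"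
    by (metis lessThan_iff)
  have vert: "same_point (v (Suc i mod 6)) (vtx p (s i) (s (Suc i mod 6))) \<and> hedge m n d (s i) (s (Suc i mod 6)) = 0"
    if "i < 6" for i
  proof -
    have "Suc i mod 6 < 6" "Suc (Suc i mod 6) mod 6 < 6" "i \<noteq> Suc i mod 6"
      "i \<noteq> Suc (Suc i mod 6) mod 6" "Suc i mod 6 \<noteq> Suc (Suc i mod 6) mod 6"
      using that by presburger+
    then show ?thesis using that
      by (intro vertex_of_two_sides[of "v i" _ "v (Suc (Suc i mod 6) mod 6)"] on ne)
         (simp_all only: s simp_thms)
  qed
  have next2: "s i \<noteq> s (Suc (Suc i mod 6) mod 6)" if "i < 6" for i
  proof -
    have "Suc i mod 6 < 6" "Suc (Suc i mod 6) mod 6 < 6" "Suc i mod 6 \<noteq> Suc (Suc i mod 6) mod 6"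
      using that by presburger+
    then show ?thesis using vert[OF that] vert[of "Suc i mod 6"]
      by (intro consecutive_vertices[of "v (Suc i mod 6)" _ _ "v (Suc (Suc i mod 6) mod 6)"] ne) blast+
  qed
  \<comment> \<open>An isotropic side has only one finite neighbour, whereas here both neighbours
    are finite and distinct.\<close>
  have iso: "(s (Suc i mod 6))\<^sup>2 + 1 \<noteq> 0" if "i < 6" for i
  proof
    define t where "t = s (Suc i mod 6)"
    assume "(s (Suc i mod 6))\<^sup>2 + 1 = 0"
    then have t: "t\<^sup>2 + 1 = 0" by (simp add: t_def)
    have "hedge m n d t (s i) = 0" using vert[OF that] by (simp add: t_def hedge_commute)
    moreover have "hedge m n d t (s (Suc (Suc i mod 6) mod 6)) = 0"
      using vert[of "Suc i mod 6"] by (simp add: t_def)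
    ultimately have "(t\<^sup>2 + 1) * (s i + s (Suc (Suc i mod 6) mod 6)) = 2 * (m * t + n)"
      using next2[OF that] by (rule hedge_sum)
    then have "2 * (m * t + n) = 0" using t by simp
    then have "t * (m - t * n) = 0" using t by algebra
    moreover have "t\<^sup>2 = -1" using t by algebra
    ultimately show False using isotropic_nonzero[of t] by auto
  qed
  have e: "hedge m n d (s 0) (s 1) = 0" "hedge m n d (s 1) (s 2) = 0" "hedge m n d (s 2) (s 3) = 0"
    "hedge m n d (s 3) (s 4) = 0" "hedge m n d (s 4) (s 5) = 0" "hedge m n d (s 5) (s 0) = 0"
    using vert[of 0] vert[of 1] vert[of 2] vert[of 3] vert[of 4] vert[of 5] by (simp_all flip: numeral_2_eq_2)
  have x: "s 0 \<noteq> s 2" "s 1 \<noteq> s 3" "s 3 \<noteq> s 5" "s 4 \<noteq> s 0" "s 5 \<noteq> s 1"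
    using next2[of 0] next2[of 1] next2[of 3] next2[of 4] next2[of 5] by (simp_all flip: numeral_2_eq_2)
  have y: "(s 0)\<^sup>2 + 1 \<noteq> 0" "(s 1)\<^sup>2 + 1 \<noteq> 0" "(s 5)\<^sup>2 + 1 \<noteq> 0"
    using iso[of 5] iso[of 0] iso[of 4] by simp_all
  \<comment> \<open>The arms are \<open>s 1, s 2\<close> and \<open>s 5, s 4\<close>; they leave
    \<open>s 0\<close> and meet at \<open>s 3\<close>.\<close>
  show ?thesis
    by (rule hexpol_generic[of m n d "s 0" "s 1" "s 5" "s 2" "s 4" "s 3"])
       (use e x y d_nonzero hedge_commute in metis)+
next
  case True
  then obtain k where k: "k < 6" "v k $ 3 = 0" "v (Suc k mod 6) $ 3 = 0" by blast
  define u where "u = (\<lambda>i. v ((k + i) mod 6))"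
  have u: "poncelet_polygon 6 (unit_circle a b) (parabola p) u"
    unfolding u_def by (rule poncelet_polygon_rotate[OF assms])
  have u01: "u 0 $ 3 = 0" "u 1 $ 3 = 0" using k by (simp_all add: u_def)
  have on: "on_conic (unit_circle a b) (u i)" if "i < 6" for i
    using u that by (simp add: poncelet_polygon_def)
  have ne: "\<not> same_point (u i) (u j)" if "i < 6" "j < 6" "i \<noteq> j" for i j
    using u that by (simp add: poncelet_polygon_def)
  obtain j where j: "j\<^sup>2 = -1" "same_point (u 1) (vtx_inf j)"
    using isotropic_point[OF on u01(2)] by auto
  \<comment> \<open>The circle has only the two circular points at infinity. Vertex \<open>1\<close>
    occupies one, so vertex \<open>0\<close> is the other and all remaining vertices are
    finite.\<close>
  have iso: "same_point (u i) (vtx_inf (-j))" if i: "i < 6" "u i $ 3 = 0" "i \<noteq> 1" for i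
  proof -
    obtain l where l: "l\<^sup>2 = -1" "same_point (u i) (vtx_inf l)"
      using isotropic_point[OF on i(2)] i by auto
    have "l \<noteq> j" using l j ne[of i 1] i same_point_sym same_point_trans by (metis one_less_numeral_iff semiring_norm(76))
    moreover have "(l - j) * (l + j) = 0" using l j by algebra
    ultimately have "l = -j" by (simp add: eq_neg_iff_add_eq_0)
    then show ?thesis using l by simp
  qed
  have u0: "same_point (u 0) (vtx_inf (-j))" using iso[of 0] u01 by simp
  have fin: "u i $ 3 \<noteq> 0" if "i < 6" "2 \<le> i" for i
    using iso[of i] that u0 ne[of i 0] same_point_sym same_point_trans by (metis not_numeral_le_zero one_less_numeral_iff order_less_le_trans zero_less_numeral numeral_le_one_iff semiring_norm(69))
  have side: "\<exists>s. on_tangent p s (u i) \<and> on_tangent p s (u (Suc i mod 6))" if "i < 6" "1 \<le> i" for i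
  proof -
    have "join_tangent (parabola p) (u i) (u (Suc i mod 6))" using u that by (simp add: poncelet_polygon_def)
    moreover have "u i $ 3 \<noteq> 0 \<or> u (Suc i mod 6) $ 3 \<noteq> 0"
      using fin[of i] fin[of 2] that by (cases "i = 1") (auto simp flip: numeral_2_eq_2)
    ultimately show ?thesis using join_tangent_cases[OF p] by blast
  qed
  obtain s1 where s1: "on_tangent p s1 (u 1)" "on_tangent p s1 (u 2)"
    using side[of 1] by (auto simp flip: numeral_2_eq_2)
  obtain s2 where s2: "on_tangent p s2 (u 2)" "on_tangent p s2 (u 3)"
    using side[of 2] by (auto simp flip: numeral_2_eq_2)
  obtain s3 where s3: "on_tangent p s3 (u 3)" "on_tangent p s3 (u 4)"
    using side[of 3] by (auto simp flip: numeral_2_eq_2)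
  obtain s4 where s4: "on_tangent p s4 (u 4)" "on_tangent p s4 (u 5)"
    using side[of 4] by (auto simp flip: numeral_2_eq_2)
  obtain s5 where s5: "on_tangent p s5 (u 5)" "on_tangent p s5 (u 0)"
    using side[of 5] by (auto simp flip: numeral_2_eq_2)
  \<comment> \<open>The finite tangent through \<open>vtx_inf l\<close> is unique, so the sides next
    to the line at infinity are isotropic.\<close>
  have inf: "s = l" if "on_tangent p s x" "same_point x (vtx_inf l)" for s l x
    using that by (auto simp: same_point_def on_tangent_def)
  have eq: "s1 = j" "s5 = -j" using inf s1 s5 j u0 by blast+
  have v2: "same_point (u 2) (vtx p s1 s2) \<and> hedge m n d s1 s2 = 0"
    by (rule vertex_of_two_sides[of "u 1" _ "u 3"]) (use on ne s1 s2 in simp_all)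
  have v3: "same_point (u 3) (vtx p s2 s3) \<and> hedge m n d s2 s3 = 0"
    by (rule vertex_of_two_sides[of "u 2" _ "u 4"]) (use on ne s2 s3 in simp_all)
  have v4: "same_point (u 4) (vtx p s3 s4) \<and> hedge m n d s3 s4 = 0"
    by (rule vertex_of_two_sides[of "u 3" _ "u 5"]) (use on ne s3 s4 in simp_all)
  have v5: "same_point (u 5) (vtx p s4 s5) \<and> hedge m n d s4 s5 = 0"
    by (rule vertex_of_two_sides[of "u 4" _ "u 0"]) (use on ne s4 s5 in simp_all)
  have "s1 \<noteq> s3" by (rule consecutive_vertices[of "u 2" _ s2 "u 3"]) (use v2 v3 ne in simp_all)
  moreover have "s3 \<noteq> s5" by (rule consecutive_vertices[of "u 4" _ s4 "u 5"]) (use v4 v5 ne in simp_all)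
  ultimately show ?thesis
    using hexpol_infinite[OF j(1), of m n d s2 s4 s3] v2 v3 v4 v5 isotropic_nonzero[OF j(1)] eq
    by (metis hedge_commute)
qed

lemma hexagon_sufficient:
  assumes Q: "hexpol m n d = 0"
  shows "\<exists>v. poncelet_polygon 6 (unit_circle a b) (parabola p) v"
proof (cases "4 * (m - \<i> * n) = d \<or> 4 * (m + \<i> * n) = d")
  case False
  obtain s w r where h: "hedge m n d \<i> s = 0" "hedge m n d s w = 0" "hedge m n d w r = 0" "hedge m n d r (-\<i>) = 0"
    and ne: "s \<noteq> -\<i>" "r \<noteq> \<i>" "s \<noteq> r" "w \<noteq> \<i>" "w \<noteq> -\<i>"
    using hexagon_infinite[of \<i> m n d] Q d_nonzero isotropic_nonzero[of \<i>] False by auto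
  have "poncelet_polygon 6 (unit_circle a b) (parabola p)
    ((!) [vtx_inf \<i>, vtx p \<i> s, vtx p s w, vtx p w r, vtx p r (-\<i>), vtx_inf (-\<i>)])"
  proof (rule poncelet_hexagonI)
    show "sorted_wrt (\<lambda>u v. \<not> same_point u v)
      [vtx_inf \<i>, vtx p \<i> s, vtx p s w, vtx p w r, vtx p r (-\<i>), vtx_inf (-\<i>)]"
      using ne p by (auto simp: same_point_vtx same_point_vtx_inf)
  qed (use h p in \<open>auto simp: on_circle_vtx on_circle_inf intro: join_tangent_inf join_tangentI on_tangent_vtx\<close>)
  then show ?thesis by blast
next
  case True
  \<comment> \<open>\<open>m\<close>, \<open>n\<close> and \<open>d\<close> are real, so imaginary
    and real parts can be compared separately.\<close>
  have "n = 0 \<and> d = 4 * m"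
  proof -
    have mr: "m = of_real (2 * a / p)" and nr: "n = of_real (2 * b / p)"
      and dr: "d = of_real (4 * (1 - a\<^sup>2 - b\<^sup>2) / p\<^sup>2)" by (simp_all add: m_def n_def d_def)
    show ?thesis using True unfolding mr nr dr complex_eq_iff by auto
  qed
  then have nd: "n = 0" "d = 4 * m" by auto
  then have "m \<noteq> 0" using d_nonzero by auto
  then obtain t y z where h: "hedge m n d t y = 0" "hedge m n d t z = 0" "hedge m n d y (-z) = 0"
    and ne: "distinct [t, y, -z, -t, -y, z]"
    using hexagon_special[of m] nd by metis
  \<comment> \<open>For \<open>n = 0\<close> the correspondence is invariant under negating both
    arguments.\<close>
  have h': "hedge m n d (-z) (-t) = 0" "hedge m n d (-t) (-y) = 0" "hedge m n d (-y) z = 0" "hedge m n d z t = 0"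
    using h by (simp_all add: hedge_def nd algebra_simps)
  have "poncelet_polygon 6 (unit_circle a b) (parabola p)
    ((!) [vtx p t y, vtx p y (-z), vtx p (-z) (-t), vtx p (-t) (-y), vtx p (-y) z, vtx p z t])"
  proof (rule poncelet_hexagonI)
    show "sorted_wrt (\<lambda>u v. \<not> same_point u v)
      [vtx p t y, vtx p y (-z), vtx p (-z) (-t), vtx p (-t) (-y), vtx p (-y) z, vtx p z t]"
      using ne p by (auto simp: same_point_vtx)
  qed (use h h' p in \<open>auto simp: on_circle_vtx intro: join_tangentI on_tangent_vtx\<close>)
  then show ?thesis by blast
qed

text \<open>\<open>m\<close> and \<open>n\<close> carry the denominator \<open>p\<close>, and
  \<open>d\<close> carries \<open>p\<^sup>2\<close>; clearing them by \<open>p^6\<close> gives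
  \<open>64\<close> times \<open>Q62\<close>.\<close>

lemma hexpol_iff_Q62: "hexpol m n d = 0 \<longleftrightarrow> poly (Q62 a b) p = 0"
proof -
  define P A B where "P = complex_of_real p" and "A = complex_of_real a" and "B = complex_of_real b"
  have Q: "of_real (poly (Q62 a b) p) = (3 * A\<^sup>2 - B\<^sup>2 + 1) * (A\<^sup>2 + B\<^sup>2 - 1)\<^sup>2
      + P * (4 * A * (2 * A\<^sup>2 + 2 * B\<^sup>2 + 1) * (A\<^sup>2 + B\<^sup>2 - 1) + P * (4 * (A\<^sup>2 + B\<^sup>2) * (A\<^sup>2 + B\<^sup>2 + 1)))"
    by (simp add: Q62_def P_def A_def B_def)
  have "P^6 * hexpol m n d =
      16 * P\<^sup>2 * ((P*m)\<^sup>2 + (P*n)\<^sup>2) * (2 * ((P*m)\<^sup>2 + (P*n)\<^sup>2) + P\<^sup>2*d)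
      - 8 * P * (P*m) * (3 * ((P*m)\<^sup>2 + (P*n)\<^sup>2) + P\<^sup>2*d) * (P\<^sup>2*d) + (4 * (P*m)\<^sup>2 + P\<^sup>2*d) * (P\<^sup>2*d)\<^sup>2"
    unfolding hexpol_def by algebra
  also have "\<dots> = 64 * of_real (poly (Q62 a b) p)"
    unfolding Q params[folded P_def A_def B_def] by algebra
  finally have "(of_real p)^6 * hexpol m n d = 64 * of_real (poly (Q62 a b) p)"
    by (simp add: P_def)
  then show ?thesis using p by (metis mult_eq_0_iff of_real_eq_0_iff power_eq_0_iff zero_neq_numeral)
qed

lemma poncelet_pair_iff: "poncelet_pair 6 (unit_circle a b) (parabola p) \<longleftrightarrow> poly (Q62 a b) p = 0"
  unfolding poncelet_pair_def hexpol_iff_Q62[symmetric]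
  using hexagon_necessary hexagon_sufficient smooth_unit_circle smooth_parabola[OF p] by auto

end

section \<open>The zeros of the polynomial\<close>

text \<open>Completing the square in \<open>p\<close> exposes the discriminant: away from the unit
  circle its sign is that of \<open>N ^ 3 - y\<^sup>2\<close>, hence the three regions.\<close>

lemma Q62_complete_square:
  fixes x y :: real
  defines "N \<equiv> x\<^sup>2 + y\<^sup>2"
  shows "N * (N + 1) * poly (Q62 x y) p
    = (2 * N * (N + 1) * p + x * (2 * N + 1) * (N - 1))\<^sup>2 - (N ^ 3 - y\<^sup>2) * (N - 1)\<^sup>2"
  unfolding Q62_def N_def by simp algebra

lemma Q62_root_iff:
  assumes "x\<^sup>2 + y\<^sup>2 \<noteq> 0"
  shows "poly (Q62 x y) p = 0 \<longleftrightarrow>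
    (2 * (x\<^sup>2 + y\<^sup>2) * (x\<^sup>2 + y\<^sup>2 + 1) * p + x * (2 * (x\<^sup>2 + y\<^sup>2) + 1) * (x\<^sup>2 + y\<^sup>2 - 1))\<^sup>2
      = ((x\<^sup>2 + y\<^sup>2) ^ 3 - y\<^sup>2) * (x\<^sup>2 + y\<^sup>2 - 1)\<^sup>2"
proof -
  have "x\<^sup>2 + y\<^sup>2 + 1 > 0" using sum_power2_ge_zero[of x y] by linarith
  then show ?thesis using Q62_complete_square[of x y p] assms by auto
qed

lemma Q62_roots:
  assumes "x\<^sup>2 + y\<^sup>2 \<noteq> 0" "(x\<^sup>2 + y\<^sup>2) ^ 3 - y\<^sup>2 \<ge> 0"
  shows "poly (Q62 x y) p = 0 \<longleftrightarrow> p = p_plus x y \<or> p = p_minus x y"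
proof -
  define N where "N = x\<^sup>2 + y\<^sup>2"
  define r where "r = sqrt (N ^ 3 - y\<^sup>2)"
  have N: "N > 0" using assms(1) sum_power2_ge_zero[of x y] unfolding N_def by linarith
  have r: "N ^ 3 - y\<^sup>2 = r\<^sup>2" using assms by (simp add: r_def N_def)
  have "poly (Q62 x y) p = 0 \<longleftrightarrow> (2 * N * (N + 1) * p + x * (2 * N + 1) * (N - 1))\<^sup>2 = (r * (N - 1))\<^sup>2"
    using Q62_root_iff[OF assms(1)] r by (simp add: N_def power_mult_distrib)
  also have "\<dots> \<longleftrightarrow> 2 * N * (N + 1) * p = (- x * (2 * N + 1) + r) * (N - 1)
      \<or> 2 * N * (N + 1) * p = (- x * (2 * N + 1) - r) * (N - 1)"
    unfolding power2_eq_iff by (auto simp: algebra_simps)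
  also have "\<dots> \<longleftrightarrow> p = (- x * (2 * N + 1) + r) * (N - 1) / (2 * N * (N + 1))
      \<or> p = (- x * (2 * N + 1) - r) * (N - 1) / (2 * N * (N + 1))"
    using N by (simp add: eq_divide_eq mult.commute)
  finally show ?thesis by (simp add: p_plus_def p_minus_def N_def r_def)
qed

lemma p_plus_neq_p_minus:
  assumes "x\<^sup>2 + y\<^sup>2 \<noteq> 1" "(x\<^sup>2 + y\<^sup>2) ^ 3 - y\<^sup>2 > 0"
  shows "p_plus x y \<noteq> p_minus x y"
proof -
  define N where "N = x\<^sup>2 + y\<^sup>2"
  define r where "r = sqrt (N ^ 3 - y\<^sup>2)"
  have "N \<noteq> 0" using assms(2) by (auto simp: N_def sum_power2_eq_zero_iff)
  then have N: "N > 0" "N \<noteq> 1" using assms(1) sum_power2_ge_zero[of x y] unfolding N_def by linarith+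
  have "r > 0" using assms by (simp add: r_def N_def)
  have "p_plus x y - p_minus x y = 2 * r * (N - 1) / (2 * N * (N + 1))"
    unfolding p_plus_def p_minus_def N_def[symmetric] r_def[symmetric] diff_divide_distrib[symmetric]
    by (simp add: N_def[symmetric] r_def algebra_simps)
  also have "\<dots> \<noteq> 0" using N \<open>r > 0\<close> by auto
  finally show ?thesis by simp
qed

lemma p_plus_eq_p_minus:
  "(x\<^sup>2 + y\<^sup>2) ^ 3 - y\<^sup>2 = 0 \<Longrightarrow> p_plus x y = p_minus x y"
  by (simp add: p_plus_def p_minus_def)

lemma order_Q62:
  assumes "x\<^sup>2 + y\<^sup>2 \<noteq> 0" "(x\<^sup>2 + y\<^sup>2) ^ 3 - y\<^sup>2 = 0"
  shows "order (p_plus x y) (Q62 x y) = 2"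
proof -
  define N where "N = x\<^sup>2 + y\<^sup>2"
  have N: "N > 0" using assms(1) sum_power2_ge_zero[of x y] unfolding N_def by linarith
  have p: "2 * N * (N + 1) * p_plus x y = - x * (2 * N + 1) * (N - 1)"
    unfolding p_plus_def N_def[symmetric] using N assms(2) by (simp add: N_def)
  have "poly (Q62 x y) q = poly (smult (4 * N * (N + 1)) ([:- p_plus x y, 1:]\<^sup>2)) q" for q
  proof -
    have "N * (N + 1) * poly (Q62 x y) q = (2 * N * (N + 1) * q + x * (2 * N + 1) * (N - 1))\<^sup>2"
      using Q62_complete_square[of x y q] assms(2) by (simp add: N_def)
    also have "\<dots> = (2 * N * (N + 1) * q - 2 * N * (N + 1) * p_plus x y)\<^sup>2"
      unfolding p by algebra
    also have "\<dots> = N * (N + 1) * (4 * N * (N + 1) * (q - p_plus x y)\<^sup>2)" by algebra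
    finally have "poly (Q62 x y) q = 4 * N * (N + 1) * (q - p_plus x y)\<^sup>2" using N by simp
    then show ?thesis by (simp add: power2_eq_square algebra_simps)
  qed
  then have "Q62 x y = smult (4 * N * (N + 1)) ([:- p_plus x y, 1:]\<^sup>2)" by (simp add: poly_eq_poly_eq_iff[symmetric] fun_eq_iff)
  then show ?thesis using N by (simp add: order_smult order_power_n_n)
qed

section \<open>Poncelet parameters and the discriminant curve\<close>

lemma poncelet_params_6:
  assumes "(x, y) \<notin> Sigma6"
  shows "poncelet_params 6 x y = {p. p \<noteq> 0 \<and> poly (Q62 x y) p = 0}"
proof -
  have "poncelet_pair 6 (unit_circle x y) (parabola p) \<longleftrightarrow> poly (Q62 x y) p = 0" if "p \<noteq> 0" for p
  proof -
    interpret circle_parabola x y p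
      using that assms by unfold_locales (auto simp: Sigma6_def)
    show ?thesis by (rule poncelet_pair_iff)
  qed
  then show ?thesis by (auto simp: poncelet_params_def)
qed

lemma Gamma6_bounds:
  assumes "(x, y) \<notin> Sigma6" "(x, y) \<in> Gamma6"
  shows "0 < x\<^sup>2 + y\<^sup>2" "x\<^sup>2 + y\<^sup>2 < 1" "x \<noteq> 0"
proof -
  define N where "N = x\<^sup>2 + y\<^sup>2"
  have N: "N \<noteq> 1" "N ^ 3 = y\<^sup>2" using assms by (auto simp: Sigma6_def Gamma6_def N_def)
  have "N \<noteq> 0" using assms by (auto simp: Sigma6_def N_def sum_power2_eq_zero_iff)
  then have pos: "N > 0" using sum_power2_ge_zero[of x y] unfolding N_def by linarith
  have "N ^ 3 \<le> N" unfolding N(2) by (simp add: N_def)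
  then have "N * N\<^sup>2 \<le> N * 1" by (simp add: power3_eq_cube power2_eq_square mult.assoc)
  then have "N\<^sup>2 \<le> 1\<^sup>2" using pos by simp
  then have "N \<le> 1" by (rule power2_le_imp_le) simp
  then show "0 < x\<^sup>2 + y\<^sup>2" "x\<^sup>2 + y\<^sup>2 < 1" using pos N by (simp_all add: N_def)
  show "x \<noteq> 0"
  proof
    assume "x = 0"
    then have "N * (N\<^sup>2 - 1) = 0" using N by (simp add: N_def power3_eq_cube power2_eq_square algebra_simps)
    then show False using N pos by (auto simp: power2_eq_1_iff)
  qed
qed

text \<open>The radical vanishes, and the cofactor of \<open>x\<close> is positive whenever
  \<open>0 < N < 1\<close>, which yields the sign.\<close>

lemma p_plus_Gamma6:
  assumes "(x, y) \<in> Gamma6"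
  shows "p_plus x y = x * ((2 * (x\<^sup>2 + y\<^sup>2) + 1) * (1 - (x\<^sup>2 + y\<^sup>2))
    / (2 * (x\<^sup>2 + y\<^sup>2) * (x\<^sup>2 + y\<^sup>2 + 1)))"
proof -
  define N where "N = x\<^sup>2 + y\<^sup>2"
  have "(x\<^sup>2 + y\<^sup>2) ^ 3 - y\<^sup>2 = 0" using assms by (simp add: Gamma6_def)
  then have "p_plus x y = (- x * (2 * N + 1) + 0) * (N - 1) / (2 * N * (N + 1))"
    unfolding p_plus_def by (simp add: N_def)
  also have "\<dots> = x * ((2 * N + 1) * (1 - N) / (2 * N * (N + 1)))"
    by (simp add: algebra_simps)
  finally show ?thesis by (simp add: N_def)
qed

lemma sgn_p_plus_Gamma6:
  assumes "(x, y) \<notin> Sigma6" "(x, y) \<in> Gamma6"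
  shows "sgn (p_plus x y) = sgn x"
  unfolding p_plus_Gamma6[OF assms(2)] sgn_mult
  using Gamma6_bounds[OF assms] by simp

text \<open>With \<open>g\<close> the cube root of \<open>y\<close>, the curve gives
  \<open>N = g\<^sup>2\<close> and \<open>x\<^sup>2 = g\<^sup>2 * (1 - g ^ 4)\<close>. This fixes
  \<open>x\<close> up to sign, hence the factor \<open>sgn x\<close>.\<close>

lemma p_plus_Gamma6_radicals:
  assumes "(x, y) \<notin> Sigma6" "(x, y) \<in> Gamma6" "0 < y"
  shows "p_plus x y = sgn x *
     (- (sqrt (1 - y powr (4/3)) * (2 * y powr (2/3) + 1) * (y powr (2/3) - 1))
        / (2 * y powr (1/3) * (y powr (2/3) + 1)))"
proof -
  define g where "g = y powr (1/3)"
  have g: "g > 0" using assms by (simp add: g_def)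
  have pw: "g ^ k = y powr (real k / 3)" for k
    using assms by (simp add: g_def powr_power)
  have y: "y = g ^ 3" "y powr (2/3) = g\<^sup>2" "y powr (4/3) = g ^ 4"
    using pw[of 3] pw[of 2] pw[of 4] assms by simp_all
  define N where "N = x\<^sup>2 + y\<^sup>2"
  note b = Gamma6_bounds[OF assms(1,2), folded N_def]
  have "N ^ 3 = (g\<^sup>2) ^ 3"
    using assms(2) y(1) by (simp add: Gamma6_def N_def flip: power_mult)
  then have N: "N = g\<^sup>2" using b(1) by (intro power_eq_imp_eq_base[of N 3]) auto
  have "x\<^sup>2 = g\<^sup>2 * (1 - g ^ 4)"
    using N unfolding N_def y(1) by (simp add: algebra_simps flip: power_mult power_add)
  then have "\<bar>x\<bar> = g * sqrt (1 - g ^ 4)"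
    using g by (metis real_sqrt_abs real_sqrt_mult abs_of_pos)
  then have x: "x = sgn x * (g * sqrt (1 - g ^ 4))"
    by (metis mult.commute mult_sgn_abs sgn_mult_abs)
  have "g\<^sup>2 + 1 > 0" by (simp add: add_nonneg_pos)
  have "p_plus x y = sgn x * (g * sqrt (1 - g ^ 4)) * ((2 * N + 1) * (1 - N) / (2 * N * (N + 1)))"
    using p_plus_Gamma6[OF assms(2)] x by (simp add: N_def)
  also have "\<dots> = sgn x * (- (sqrt (1 - g ^ 4) * (2 * g\<^sup>2 + 1) * (g\<^sup>2 - 1)) / (2 * g * (g\<^sup>2 + 1)))"
    unfolding N using g \<open>g\<^sup>2 + 1 > 0\<close> by (simp add: divide_simps) algebra
  finally show ?thesis unfolding y(2,3) g_def .
qed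

text \<open>The value \<open>0\<close> is removed because it gives no parabola of the family; it is
  a zero of \<open>Q62\<close> exactly when its constant term vanishes. The factor
  \<open>sgn xE\<close> covers both branches of the curve.\<close>

theorem proposition4p4:
  fixes xE yE :: real
  assumes "(xE, yE) \<notin> Sigma6"
  shows
    "((xE, yE) \<in> Gamma6_pos \<longrightarrow>
        p_plus xE yE \<noteq> p_minus xE yE \<and>
        {p. poly (Q62 xE yE) p = 0} = {p_plus xE yE, p_minus xE yE} \<and>
        poncelet_params 6 xE yE = {p_plus xE yE, p_minus xE yE} - {0} \<and>
        (0 \<in> {p_plus xE yE, p_minus xE yE} \<longleftrightarrow> 3 * xE\<^sup>2 - yE\<^sup>2 + 1 = 0))
     \<and> ((xE, yE) \<in> Gamma6 \<longrightarrow>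
        p_plus xE yE = p_minus xE yE \<and>
        {p. poly (Q62 xE yE) p = 0} = {p_plus xE yE} \<and>
        order (p_plus xE yE) (Q62 xE yE) = 2 \<and>
        poncelet_params 6 xE yE = {p_plus xE yE} \<and>
        sgn (p_plus xE yE) = sgn xE \<and> sgn (p_minus xE yE) = sgn xE \<and>
        (0 < yE \<and> yE < 1 \<longrightarrow>
           p_plus xE yE = sgn xE *
             (- (sqrt (1 - yE powr (4/3)) * (2 * yE powr (2/3) + 1) * (yE powr (2/3) - 1))
                / (2 * yE powr (1/3) * (yE powr (2/3) + 1)))))
     \<and> ((xE, yE) \<in> Gamma6_neg \<longrightarrow> poncelet_params 6 xE yE = {})"
proof (intro conjI impI)
  have N: "xE\<^sup>2 + yE\<^sup>2 \<noteq> 1" "xE\<^sup>2 + yE\<^sup>2 \<noteq> 0"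
    using assms by (auto simp: Sigma6_def sum_power2_eq_zero_iff)
  note params = poncelet_params_6[OF assms]
  {
    assume "(xE, yE) \<in> Gamma6_pos"
    then have pos: "(xE\<^sup>2 + yE\<^sup>2) ^ 3 - yE\<^sup>2 > 0" by (simp add: Gamma6_pos_def)
    note roots = Q62_roots[OF N(2) less_imp_le[OF pos]]
    show "p_plus xE yE \<noteq> p_minus xE yE" using p_plus_neq_p_minus[OF N(1) pos] .
    show "{p. poly (Q62 xE yE) p = 0} = {p_plus xE yE, p_minus xE yE}" using roots by auto
    show "poncelet_params 6 xE yE = {p_plus xE yE, p_minus xE yE} - {0}"
      using params roots by auto
    have "0 \<in> {p_plus xE yE, p_minus xE yE} \<longleftrightarrow> poly (Q62 xE yE) 0 = 0" using roots by auto
    also have "\<dots> \<longleftrightarrow> 3 * xE\<^sup>2 - yE\<^sup>2 + 1 = 0" using N by (simp add: Q62_def)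
    finally show "0 \<in> {p_plus xE yE, p_minus xE yE} \<longleftrightarrow> 3 * xE\<^sup>2 - yE\<^sup>2 + 1 = 0" .
  }
  {
    assume G: "(xE, yE) \<in> Gamma6"
    then have zero: "(xE\<^sup>2 + yE\<^sup>2) ^ 3 - yE\<^sup>2 = 0" by (simp add: Gamma6_def)
    show eq: "p_plus xE yE = p_minus xE yE" using p_plus_eq_p_minus[OF zero] .
    have roots: "poly (Q62 xE yE) p = 0 \<longleftrightarrow> p = p_plus xE yE" for p
      using Q62_roots[OF N(2)] zero eq by simp
    then show "{p. poly (Q62 xE yE) p = 0} = {p_plus xE yE}" by auto
    show "order (p_plus xE yE) (Q62 xE yE) = 2" by (rule order_Q62[OF N(2) zero])
    show sgn: "sgn (p_plus xE yE) = sgn xE" by (rule sgn_p_plus_Gamma6[OF assms G])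
    then show "sgn (p_minus xE yE) = sgn xE" using eq by simp
    have "p_plus xE yE \<noteq> 0" using sgn Gamma6_bounds(3)[OF assms G] by (auto simp: sgn_eq_0_iff)
    then show "poncelet_params 6 xE yE = {p_plus xE yE}" using params roots by auto
    assume "0 < yE \<and> yE < 1"
    then show "p_plus xE yE = sgn xE *
        (- (sqrt (1 - yE powr (4/3)) * (2 * yE powr (2/3) + 1) * (yE powr (2/3) - 1))
          / (2 * yE powr (1/3) * (yE powr (2/3) + 1)))"
      using p_plus_Gamma6_radicals[OF assms G] by blast
  }
  {
    assume "(xE, yE) \<in> Gamma6_neg"
    then have "(xE\<^sup>2 + yE\<^sup>2) ^ 3 - yE\<^sup>2 < 0" by (simp add: Gamma6_neg_def)
    \<comment> \<open>After completing the square, a zero would make a real square negative.\<close>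
    then have "((xE\<^sup>2 + yE\<^sup>2) ^ 3 - yE\<^sup>2) * (xE\<^sup>2 + yE\<^sup>2 - 1)\<^sup>2 < 0"
      using N by (simp add: mult_neg_pos)
    then have "poly (Q62 xE yE) p \<noteq> 0" for p
      unfolding Q62_root_iff[OF N(2)] using zero_le_power2 by (metis not_le)
    then show "poncelet_params 6 xE yE = {}" using params by auto
  }
qed

end
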